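(* Let $A\in\mathbb{H}^{m\times n}$, let $M$ and $N$ be positive definite quaternion matrices of order $m$ and $n$, and let $AA^{\sharp}\in\mathbb{H}^{m\times m}$ be Hermitian. Let $b\in\mathbb{H}^{1\times n}$, let $\tilde x=(\tilde x_1,\dots,\tilde x_m)$ be the weighted Moore-Penrose solution of the left system $xA=b$, and put $g=bA^{\sharp}$. (i) If $\mathrm{rank}\,A=r\le n<m$, then for all $j=1,\dots,m$ $$\tilde x_j=\frac{\sum_{\alpha\in I_{r,m}\{j\}}\mathrm{rdet}_j\left(\left(AA^{\sharp}\right)_{j.}(g)\right)^{\alpha}_{\alpha}}{\sum_{\alpha\in I_{r,m}}\left|\left(AA^{\sharp}\right)^{\alpha}_{\alpha}\right|}.$$ (ii) If $\mathrm{rank}\,A=m$, then for all $j=1,\dots,m$ $$\tilde x_j=\frac{\mathrm{rdet}_j\left(\left(AA^{\sharp}\right)_{j.}(g)\right)}{\det(AA^{\sharp})}.$$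
   Context: $\mathbb{H}$ is the skew field of real quaternions; $A^{*}$ is the conjugate transpose; $B$ is Hermitian if $B^{*}=B$; $P$ is positive definite if it is Hermitian and $x^{*}Px>0$ for all nonzero columns $x$. $A^{\sharp}:=N^{-1}A^{*}M$. The weighted Moore-Penrose inverse $A^{\dagger}_{M,N}$ is the unique $X\in\mathbb{H}^{n\times m}$ with $AXA=A$, $XAX=X$, $(MAX)^{*}=MAX$, $(NXA)^{*}=NXA$. The weighted Moore-Penrose solution of $xA=b$ is $\tilde x=bA^{\dagger}_{M,N}$. Row determinants of $B=(b_{ij})\in\mathbb{H}^{n\times n}$. For fixed $i$, write each $\sigma\in S_n$ as a product of $r=r(\sigma)$ disjoint cycles (1-cycles included) $\sigma=(i\,i_{k_1}\,i_{k_1+1}\ldots i_{k_1+l_1})(i_{k_2}\,i_{k_2+1}\ldots i_{k_2+l_2})\cdots(i_{k_r}\,i_{k_r+1}\ldots i_{k_r+l_r})$, the first cycle starting with $i$, every other cycle starting with its smallest element, and $i_{k_2}<i_{k_3}<\dots<i_{k_r}$. Then $$\mathrm{rdet}_i B=\sum_{\sigma\in S_n}(-1)^{n-r}\,b_{i i_{k_1}}b_{i_{k_1}i_{k_1+1}}\cdots b_{i_{k_1+l_1}i}\cdots b_{i_{k_r}i_{k_r+1}}\cdots b_{i_{k_r+l_r}i_{k_r}}.$$ (A 1-cycle $(s)$ contributes the factor $b_{ss}$.) For Hermitian $B$ all $\mathrm{rdet}_iB$ coincide and are real; the common value is $\det B$. $B_{j.}(c)$ is $B$ with its $j$-th row replaced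 by the row $c$. $B^{\alpha}_{\alpha}$ is the principal submatrix with rows and columns indexed by $\alpha$; its rows and columns keep their original indices, so that $\mathrm{rdet}_j(B)^{\alpha}_{\alpha}$ is the row determinant of the submatrix along the row with original index $j\in\alpha$. For Hermitian $B$, $|B^{\alpha}_{\alpha}|=\det(B^{\alpha}_{\alpha})$. $L_{k,m}$ ($1\le k\le m$) is the set of strictly increasing sequences of $k$ integers from $\{1,\dots,m\}$; $I_{r,m}=L_{r,m}$, $I_{r,m}\{j\}=\{\alpha\in L_{r,m}: j\in\alpha\}$; $r\ge1$ is understood. *)

theory Defs
  imports
    Complex_Main
    "Jordan_Normal_Form.Matrix"
    "HOL-Combinatorics.Cycles"
begin

section \<open>The skew field of real quaternions\<close>

datatype quat = Quat (qre: real) (qi: real) (qj: real) (qk: real)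

lemma quat_eq_iff: "x = y \<longleftrightarrow> qre x = qre y \<and> qi x = qi y \<and> qj x = qj y \<and> qk x = qk y"
  by (cases x; cases y) auto

instantiation quat :: ab_group_add
begin

definition "0 = Quat 0 0 0 0"
definition "x + y = Quat (qre x + qre y) (qi x + qi y) (qj x + qj y) (qk x + qk y)"
definition "- x = Quat (- qre x) (- qi x) (- qj x) (- qk x)"
definition "x - y = Quat (qre x - qre y) (qi x - qi y) (qj x - qj y) (qk x - qk y)"

instance
  by standard
    (auto simp: quat_eq_iff zero_quat_def plus_quat_def uminus_quat_def minus_quat_def)

end

instantiation quat :: real_div_algebra
begin

definition "1 = Quat 1 0 0 0"

definition "x * y = Quat
  (qre x * qre y - qi x * qi y - qj x * qj y - qk x * qk y)
  (qre x * qi y + qi x * qre y + qj x * qk y - qk x * qj y)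
  (qre x * qj y - qi x * qk y + qj x * qre y + qk x * qi y)
  (qre x * qk y + qi x * qj y - qj x * qi y + qk x * qre y)"

definition "scaleR r x = Quat (r * qre x) (r * qi x) (r * qj x) (r * qk x)"

definition "inverse x =
  (let s = (qre x)\<^sup>2 + (qi x)\<^sup>2 + (qj x)\<^sup>2 + (qk x)\<^sup>2
   in Quat (qre x / s) (- qi x / s) (- qj x / s) (- qk x / s))"

definition "x div (y :: quat) = x * inverse y"

instance
proof
  fix x :: quat
  assume "x \<noteq> 0"
  define s where "s = (qre x)\<^sup>2 + (qi x)\<^sup>2 + (qj x)\<^sup>2 + (qk x)\<^sup>2"
  have "s \<noteq> 0"
    using \<open>x \<noteq> 0\<close> unfolding s_def quat_eq_iff zero_quat_def
    by (simp add: add_nonneg_eq_0_iff)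
  have s: "(qre x * qre x + qi x * qi x + qj x * qj x + qk x * qk x) / s = 1"
    using \<open>s \<noteq> 0\<close> by (simp add: s_def power2_eq_square)
  show "inverse x * x = 1" "x * inverse x = 1"
    using s
    by (auto simp: inverse_quat_def Let_def s_def[symmetric] times_quat_def one_quat_def
        add_divide_distrib mult.commute)
qed (auto simp: quat_eq_iff zero_quat_def plus_quat_def one_quat_def times_quat_def
      scaleR_quat_def divide_quat_def inverse_quat_def algebra_simps)

end

definition qcnj :: "quat \<Rightarrow> quat" where
  "qcnj x = Quat (qre x) (- qi x) (- qj x) (- qk x)"


section \<open>Quaternion matrices\<close>

text \<open>
  Matrices carry their dimensions explicitly and are indexed from 0. Rows and columns of length
  \<open>n\<close> are \<open>1 \<times> n\<close> and \<open>n \<times> 1\<close> matrices.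
\<close>

definition ctrans :: "quat mat \<Rightarrow> quat mat" where
  "ctrans A = mat (dim_col A) (dim_row A) (\<lambda>(i, j). qcnj (A $$ (j, i)))"

definition hermitian :: "quat mat \<Rightarrow> bool" where
  "hermitian B \<longleftrightarrow> ctrans B = B"

definition pos_def :: "quat mat \<Rightarrow> bool" where
  "pos_def P \<longleftrightarrow> hermitian P \<and>
     (\<forall>x \<in> carrier_mat (dim_row P) 1. x \<noteq> 0\<^sub>m (dim_row P) 1 \<longrightarrow>
        (\<exists>t > 0. (ctrans x * P * x) $$ (0, 0) = of_real t))"

definition mat_inv :: "quat mat \<Rightarrow> quat mat" where
  "mat_inv A = (THE X. X \<in> carrier_mat (dim_col A) (dim_row A) \<and> inverts_mat A X \<and> inverts_mat X A)"

definition wadj :: "quat mat \<Rightarrow> quat mat \<Rightarrow> quat mat \<Rightarrow> quat mat" where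
  "wadj M N A = mat_inv N * ctrans A * M"

definition is_wmp_inverse :: "quat mat \<Rightarrow> quat mat \<Rightarrow> quat mat \<Rightarrow> quat mat \<Rightarrow> bool" where
  "is_wmp_inverse M N A X \<longleftrightarrow>
     X \<in> carrier_mat (dim_col A) (dim_row A) \<and>
     A * X * A = A \<and> X * A * X = X \<and>
     ctrans (M * A * X) = M * A * X \<and>
     ctrans (N * X * A) = N * X * A"

definition wmp_inverse :: "quat mat \<Rightarrow> quat mat \<Rightarrow> quat mat \<Rightarrow> quat mat" where
  "wmp_inverse M N A = (THE X. is_wmp_inverse M N A X)"

text \<open>
  The rank is the maximal number of right linearly independent columns. Over a skew field this is
  also the maximal number of left linearly independent rows.
\<close>

definition right_indep_cols :: "quat mat \<Rightarrow> nat set \<Rightarrow> bool" where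
  "right_indep_cols A S \<longleftrightarrow>
     (\<forall>c :: nat \<Rightarrow> quat. (\<forall>i < dim_row A. (\<Sum>k\<in>S. A $$ (i, k) * c k) = 0) \<longrightarrow> (\<forall>k\<in>S. c k = 0))"

definition qrank :: "quat mat \<Rightarrow> nat" where
  "qrank A = Max {card S |S. S \<subseteq> {..<dim_col A} \<and> right_indep_cols A S}"

definition replace_row :: "quat mat \<Rightarrow> nat \<Rightarrow> quat mat \<Rightarrow> quat mat" where
  "replace_row B j c =
     mat (dim_row B) (dim_col B) (\<lambda>(i, k). if i = j then c $$ (0, k) else B $$ (i, k))"


section \<open>Row determinants\<close>

text \<open>
  The list \<open>support \<sigma> s\<close> is \<open>[s, \<sigma> s, \<sigma> (\<sigma> s), \<dots>]\<close>, the cycle of \<open>s\<close> under \<open>\<sigma>\<close> written with \<open>s\<close>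
  first. The factors do not commute, so their order matters.
\<close>

definition cycle_prod :: "quat mat \<Rightarrow> (nat \<Rightarrow> nat) \<Rightarrow> nat \<Rightarrow> quat" where
  "cycle_prod B \<sigma> s = prod_list (map (\<lambda>t. B $$ (t, \<sigma> t)) (support \<sigma> s))"

text \<open>
  The increasing list of the smallest elements of the cycles of \<open>\<sigma>\<close> on \<open>\<alpha>\<close>, 1-cycles included and
  the cycle of \<open>i\<close> left out.
\<close>

definition other_leaders :: "nat set \<Rightarrow> nat \<Rightarrow> (nat \<Rightarrow> nat) \<Rightarrow> nat list" where
  "other_leaders \<alpha> i \<sigma> = sorted_list_of_set
     {s \<in> \<alpha>. s \<notin> set (support \<sigma> i) \<and> (\<forall>t \<in> set (support \<sigma> s). s \<le> t)}"

text \<open>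
  \<open>rdet_on \<alpha> i B\<close> is the row determinant, along the row with original index \<open>i \<in> \<alpha>\<close>, of the
  principal submatrix of \<open>B\<close> with rows and columns in \<open>\<alpha>\<close>. The permutation \<open>\<sigma>\<close> has
  \<open>1 + length (other_leaders \<alpha> i \<sigma>)\<close> cycles on \<open>\<alpha>\<close>.
\<close>

definition rdet_on :: "nat set \<Rightarrow> nat \<Rightarrow> quat mat \<Rightarrow> quat" where
  "rdet_on \<alpha> i B = (\<Sum>\<sigma> | \<sigma> permutes \<alpha>.
     (- 1) ^ (card \<alpha> - (1 + length (other_leaders \<alpha> i \<sigma>))) *
     (cycle_prod B \<sigma> i * prod_list (map (cycle_prod B \<sigma>) (other_leaders \<alpha> i \<sigma>))))"

definition rdet :: "nat \<Rightarrow> quat mat \<Rightarrow> quat" where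
  "rdet i B = rdet_on {..<dim_row B} i B"

text \<open>
  The determinant of (a nonempty principal submatrix of) a Hermitian matrix is the common value of
  all its row determinants. It is real, but is kept as an element of \<^typ>\<open>quat\<close>.
\<close>

definition hdet_on :: "nat set \<Rightarrow> quat mat \<Rightarrow> quat" where
  "hdet_on \<alpha> B = (THE d. \<forall>i\<in>\<alpha>. rdet_on \<alpha> i B = d)"

definition hdet :: "quat mat \<Rightarrow> quat" where
  "hdet B = hdet_on {..<dim_row B} B"

text \<open>Strictly increasing sequences are represented by the sets of their entries.\<close>

definition idx :: "nat \<Rightarrow> nat \<Rightarrow> nat set set" where
  "idx r m = {\<alpha>. \<alpha> \<subseteq> {..<m} \<and> card \<alpha> = r}"

definition idx_with :: "nat \<Rightarrow> nat \<Rightarrow> nat \<Rightarrow> nat set set" where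
  "idx_with r m j = {\<alpha> \<in> idx r m. j \<in> \<alpha>}"

end

theory Submission
  imports Defs
begin

text \<open>
  Let \<open>d\<^sub>k\<close> be the sum of the principal minors of order \<open>k\<close> of the Hermitian matrix \<open>G = A A\<^sup>\<sharp>\<close> and
  \<open>C\<^sub>k\<close> the matrix of cofactors summed over the index sets of size \<open>k\<close>. Expanding row determinants
  along the cycle through the distinguished row gives the Faddeev-LeVerrier recursion
  \<open>C\<^bsub>k+1\<^esub> = d\<^sub>k I - G C\<^sub>k\<close>, and the numerators of the formula are the entries of \<open>g C\<^sub>r\<close>.
  For the last \<open>p\<close> with \<open>d\<^sub>p \<noteq> 0\<close> one has \<open>G C\<^bsub>p+1\<^esub> = 0\<close>, which by positive definiteness of \<open>M\<close> and \<open>N\<close>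
  implies \<open>C\<^bsub>p+1\<^esub> A = 0\<close>. Then \<open>G C\<^sub>p / d\<^sub>p\<close> is idempotent with the column space of \<open>A\<close> and with real trace
  \<open>p\<close>, so \<open>p\<close> is the rank of \<open>A\<close>, and the recursion shows that \<open>A\<^sup>\<sharp> C\<^sub>p / d\<^sub>p\<close> satisfies the four defining
  equations of the weighted Moore-Penrose inverse.
\<close>

section \<open>Expansion of row determinants along a cycle\<close>

text \<open>The factors follow the path, since they do not commute. Separate end points admit open
  walks, which arise when the first step of a cycle is split off; a cycle is the case
  \<open>s = t\<close>.\<close>

fun walk :: "quat mat \<Rightarrow> nat \<Rightarrow> nat list \<Rightarrow> nat \<Rightarrow> quat" where
  "walk B s [] t = B $$ (s, t)"
| "walk B s (x # xs) t = B $$ (s, x) * walk B x xs t"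

text \<open>Interior points of simple walks. A cycle through \<open>i\<close> inside
  \<open>\<alpha>\<close>, written with \<open>i\<close> first, is exactly one list in
  \<open>dlists (\<alpha> - {i})\<close>.\<close>

definition dlists :: "nat set \<Rightarrow> nat list set" where
  "dlists T = {xs. distinct xs \<and> set xs \<subseteq> T}"

text \<open>What remains of a row determinant once the cycle through the chosen row is removed: the
  other cycles are led by their smallest elements, so the expansion runs along \<open>Min T\<close>.
  If nothing is left, the empty product gives 1.\<close>

definition min_rdet :: "quat mat \<Rightarrow> nat set \<Rightarrow> quat" where
  "min_rdet B T = (if T = {} then 1 else rdet_on T (Min T) B)"

lemma finite_dlists [simp]: "finite T \<Longrightarrow> finite (dlists T)"
  using finite_subset_distinct[of T] by (simp add: dlists_def conj_commute)

text \<open>The \<open>k\<close>-th iterate of \<open>f\<close> at \<open>i\<close> sits at position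
  \<open>k\<close> modulo the length, and distinctness makes the length the first return time, on
  which \<open>support\<close> is built.\<close>

lemma support_eqI:
  assumes d: "distinct (i # xs)" and f: "map f (i # xs) = xs @ [i]"
  shows "support f i = i # xs"
proof -
  let ?c = "i # xs" let ?n = "length ?c"
  have fk: "f (?c ! k) = ?c ! (Suc k mod ?n)" if "k < ?n" for k
  proof -
    have "f (?c ! k) = (xs @ [i]) ! k"
      using that f by (metis nth_map)
    also have "\<dots> = ?c ! (Suc k mod ?n)"
      using that by (cases "k = length xs") (auto simp: nth_append)
    finally show ?thesis .
  qed
  have pw: "(f ^^ k) i = ?c ! (k mod ?n)" for k
  proof (induction k)
    case (Suc k)
    have "(f ^^ Suc k) i = f (?c ! (k mod ?n))" using Suc by simp
    also have "\<dots> = ?c ! (Suc (k mod ?n) mod ?n)" by (rule fk) simp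
    finally show ?case by (simp add: mod_Suc_eq)
  qed simp
  have "least_power f i = ?n"
    unfolding least_power_def
  proof (rule Least_equality)
    show "(f ^^ ?n) i = i \<and> ?n > 0" using pw[of ?n] by simp
    fix k assume k: "(f ^^ k) i = i \<and> k > 0"
    hence "?c ! (k mod ?n) = ?c ! 0" using pw[of k] by simp
    hence "k mod ?n = 0"
      using nth_eq_iff_index_eq[OF d, of "k mod ?n" 0] by (simp del: mod_0_imp_dvd)
    thus "?n \<le> k" using k by (auto dest: dvd_imp_le)
  qed
  thus ?thesis
    by (intro nth_equalityI) (simp_all only: length_map length_upt nth_map_upt pw diff_zero nth_map nth_upt add_0 mod_less)
qed

lemma support_cong:
  assumes "\<And>n. (f ^^ n) s = (g ^^ n) s"
  shows "support f s = support g s"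
  unfolding least_power_def assms ..

lemma walk_eq_prod_list:
  "map f (s # xs) = xs @ [t] \<Longrightarrow> walk B s xs t = prod_list (map (\<lambda>u. B $$ (u, f u)) (s # xs))"
  by (induction xs arbitrary: s) auto

lemma cycle_prod_eq_walk:
  assumes "support f i = i # xs" "map f (i # xs) = xs @ [i]"
  shows "cycle_prod B f i = walk B i xs i"
  unfolding cycle_prod_def assms(1) using walk_eq_prod_list[OF assms(2)] by simp

lemma support_subset:
  assumes "\<sigma> permutes T" "s \<in> T"
  shows "set (support \<sigma> s) \<subseteq> T"
  using permutes_in_image[OF permutes_funpow[OF assms(1)]] assms(2) by auto

lemma self_in_support:
  assumes "\<sigma> permutes T" "finite T"
  shows "s \<in> set (support \<sigma> s)"
proof -
  have "permutation \<sigma>" using assms permutation_permutes by blast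
  from support_set[OF this, of s] show ?thesis by (metis funpow_0 rangeI)
qed

context
  fixes \<alpha> :: "nat set" and i :: nat and xs :: "nat list"
  assumes fin: "finite \<alpha>" and i: "i \<in> \<alpha>" and xs: "xs \<in> dlists (\<alpha> - {i})"
begin

lemma distinct_Cons_dlists: "distinct (i # xs)" "set (i # xs) \<subseteq> \<alpha>"
  using xs i by (auto simp: dlists_def)

text \<open>The cycle and \<open>\<tau>\<close> move disjoint sets of points. The conclusions are
  what the bijection in \<open>rdet_on_decomp\<close> and the comparison of its summands
  need.\<close>

lemma permutes_comp_cycle:
  assumes t: "\<tau> permutes \<alpha> - set (i # xs)"
  shows "\<tau> \<circ> cycle_of_list (i # xs) permutes \<alpha>"
    and "map (\<tau> \<circ> cycle_of_list (i # xs)) (i # xs) = xs @ [i]"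
    and "support (\<tau> \<circ> cycle_of_list (i # xs)) i = i # xs"
    and "s \<in> \<alpha> - set (i # xs) \<Longrightarrow> support (\<tau> \<circ> cycle_of_list (i # xs)) s = support \<tau> s"
    and "(\<lambda>y. if y \<in> \<alpha> - set (i # xs) then (\<tau> \<circ> cycle_of_list (i # xs)) y else y) = \<tau>"
proof -
  let ?c = "cycle_of_list (i # xs)" let ?s = "\<tau> \<circ> ?c"
  show "?s permutes \<alpha>"
    using permutes_compose[OF permutes_subset[OF cycle_permutes distinct_Cons_dlists(2)]
        permutes_subset[OF t Diff_subset]] .
  have c: "map ?c (i # xs) = xs @ [i]"
    using cyclic_rotation[OF distinct_Cons_dlists(1), of 1] by simp
  have t_id: "\<tau> y = y" if "y \<notin> \<alpha> - set (i # xs)" for y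
    using t that by (simp add: permutes_def)
  have "map ?s (i # xs) = map \<tau> (map ?c (i # xs))" by simp
  also have "\<dots> = xs @ [i]"
    unfolding c by (rule map_idI) (use t_id in auto)
  finally show *: "map ?s (i # xs) = xs @ [i]" .
  show "support ?s i = i # xs"
    by (rule support_eqI[OF distinct_Cons_dlists(1) *])
  have agree: "?s y = \<tau> y" if "y \<in> \<alpha> - set (i # xs)" for y
    using id_outside_supp[of y "i # xs"] that by (simp del: cycle_of_list.simps)
  show "support ?s s = support \<tau> s" if s: "s \<in> \<alpha> - set (i # xs)"
  proof (rule support_cong)
    fix n
    show "(?s ^^ n) s = (\<tau> ^^ n) s"
    proof (induction n)
      case (Suc n)
      have "(\<tau> ^^ n) s \<in> \<alpha> - set (i # xs)"
        using permutes_in_image[OF permutes_funpow[OF t]] s by blast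
      thus ?case using Suc agree by simp
    qed simp
  qed
  show "(\<lambda>y. if y \<in> \<alpha> - set (i # xs) then ?s y else y) = \<tau>"
    using agree t_id by (auto simp: fun_eq_iff simp del: cycle_of_list.simps)
qed

text \<open>Sorted, the leaders of \<open>\<sigma>\<close> off the cycle of \<open>i\<close> start
  with \<open>Min T\<close>, and the rest are the \<open>other_leaders\<close> of
  \<open>\<tau>\<close> along \<open>Min T\<close>. So the trailing product with its sign is one
  summand of \<open>rdet_on T (Min T) B\<close>.\<close>

lemma leaders_summand:
  assumes t: "\<tau> permutes \<alpha> - set (i # xs)"
  defines "\<sigma> \<equiv> \<tau> \<circ> cycle_of_list (i # xs)" and "T \<equiv> \<alpha> - set (i # xs)"
  shows "(- 1) ^ (card \<alpha> - (1 + length (other_leaders \<alpha> i \<sigma>))) *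
     (cycle_prod B \<sigma> i * prod_list (map (cycle_prod B \<sigma>) (other_leaders \<alpha> i \<sigma>))) =
     (- 1) ^ length xs * walk B i xs i *
     (if T = {} then 1 else (- 1) ^ (card T - (1 + length (other_leaders T (Min T) \<tau>))) *
     (cycle_prod B \<tau> (Min T) * prod_list (map (cycle_prod B \<tau>) (other_leaders T (Min T) \<tau>))))"
proof -
  note P = permutes_comp_cycle[OF t, folded \<sigma>_def T_def]
  have finT: "finite T" using fin by (simp add: T_def)
  have tT: "\<tau> permutes T" using t by (simp add: T_def)
  have cp: "cycle_prod B \<sigma> i = walk B i xs i"
    by (rule cycle_prod_eq_walk[OF P(3,2)])
  have cpT: "cycle_prod B \<sigma> s = cycle_prod B \<tau> s" if s: "s \<in> T" for s
  proof -
    have "\<sigma> u = \<tau> u" if "u \<in> set (support \<tau> s)" for u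
    proof -
      have "u \<in> T" using support_subset[OF tT s] that by blast
      thus ?thesis using fun_cong[OF P(5), of u] by simp
    qed
    thus ?thesis unfolding cycle_prod_def P(4)[OF s] by (intro arg_cong[of _ _ prod_list] map_cong) auto
  qed
  have card: "card \<alpha> = Suc (length xs) + card T"
    using distinct_card[OF distinct_Cons_dlists(1)] card_mono[OF fin distinct_Cons_dlists(2)]
    by (simp add: T_def card_Diff_subset[OF _ distinct_Cons_dlists(2)] del: list.set)
  define L where "L = {s \<in> \<alpha>. s \<notin> set (support \<sigma> i) \<and> (\<forall>t \<in> set (support \<sigma> s). s \<le> t)}"
  have L: "L = {s \<in> T. \<forall>t \<in> set (support \<tau> s). s \<le> t}"
    unfolding L_def P(3) using P(4) by (fastforce simp: T_def simp del: set_map)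
  have LT: "L \<subseteq> T" using L by auto
  have ol: "other_leaders \<alpha> i \<sigma> = sorted_list_of_set L"
    by (simp only: other_leaders_def L_def)
  show ?thesis
  proof (cases "T = {}")
    case True
    thus ?thesis using LT card ol cp by simp
  next
    case False
    let ?m = "Min T"
    have m: "?m \<in> T" using False finT by simp
    have mL: "?m \<in> L"
      unfolding L using m support_subset[OF tT m] finT by (auto intro!: Min_le)
    have finL: "finite L" using LT finT finite_subset by blast
    have MinL: "Min L = ?m"
      by (rule Min_eqI[OF finL _ mL]) (use LT finT in auto)
    have perm: "permutation \<tau>" using tT finT permutation_permutes by blast
    \<comment> \<open>A leader in the cycle of \<open>Min T\<close> is at most \<open>Min T\<close>,
      hence equal to it.\<close>
    have "L - {?m} = {s \<in> T. s \<notin> set (support \<tau> ?m) \<and> (\<forall>t \<in> set (support \<tau> s). s \<le> t)}" (is "_ = ?R")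
    proof (intro equalityI subsetI)
      fix s assume s: "s \<in> L - {?m}"
      have "s \<notin> set (support \<tau> ?m)"
      proof
        assume "s \<in> set (support \<tau> ?m)"
        hence "set (support \<tau> s) \<inter> set (support \<tau> ?m) \<noteq> {}"
          using self_in_support[OF tT finT, of s] by blast
        hence "?m \<in> set (support \<tau> s)"
          using disjoint_support'[OF perm, of ?m s] by (simp only: Int_commute) blast
        hence "s \<le> ?m" using s L by (simp del: set_map)
        moreover have "?m \<le> s" using s LT finT by (simp add: subset_iff)
        ultimately show False using s by simp
      qed
      thus "s \<in> ?R" using s L by (simp del: set_map)
    next
      fix s assume "s \<in> ?R"
      thus "s \<in> L - {?m}" using self_in_support[OF tT finT, of ?m] L by (auto simp del: set_map)
    qed
    hence olT: "other_leaders T ?m \<tau> = sorted_list_of_set (L - {?m})"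
      by (simp only: other_leaders_def)
    have ol': "other_leaders \<alpha> i \<sigma> = ?m # other_leaders T ?m \<tau>"
      using sorted_list_of_set_nonempty[OF finL] mL unfolding ol olT MinL by blast
    have sub: "set (other_leaders T ?m \<tau>) \<subseteq> T" using olT finL LT by auto
    have "length (other_leaders T ?m \<tau>) = card L - 1"
      using mL finL by (simp add: olT)
    \<comment> \<open>The exponents use truncated subtraction; this bound makes them add up.\<close>
    hence len: "1 + length (other_leaders T ?m \<tau>) \<le> card T"
      using card_mono[OF finT LT] mL finL by (metis Suc_pred' card_gt_0_iff empty_iff plus_1_eq_Suc)
    have e: "card \<alpha> - (1 + length (other_leaders \<alpha> i \<sigma>)) =
        length xs + (card T - (1 + length (other_leaders T ?m \<tau>)))"
      using len card by (simp add: ol')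
    have pl: "map (cycle_prod B \<sigma>) (other_leaders T ?m \<tau>) = map (cycle_prod B \<tau>) (other_leaders T ?m \<tau>)"
      using sub cpT by (intro map_cong) auto
    have sgn: "(- 1) ^ (k + l) * (w * z) = (- 1) ^ k * w * ((- 1) ^ l * z)" for w z :: quat and k l
      by (cases "even k"; cases "even l") auto
    show ?thesis
      unfolding e unfolding ol' list.map prod_list.Cons cp pl cpT[OF m] sgn if_not_P[OF False] ..
  qed
qed

end

text \<open>
  A permutation of \<open>\<alpha>\<close> is the cycle through \<open>i\<close>, written as the list of the other points of the
  cycle, together with a permutation of the remaining points. The product over the remaining
  cycles is a row determinant again, since their leaders start with the smallest point left.
\<close>

lemma rdet_on_decomp:
  assumes fin: "finite \<alpha>" and i: "i \<in> \<alpha>"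
  shows "rdet_on \<alpha> i B = (\<Sum>xs\<in>dlists (\<alpha> - {i}).
    (- 1) ^ length xs * walk B i xs i * min_rdet B (\<alpha> - {i} - set xs))"
proof -
  define F where "F T \<tau> = (if T = {} then 1 else (- 1) ^ (card T - (1 + length (other_leaders T (Min T) \<tau>))) *
     (cycle_prod B \<tau> (Min T) * prod_list (map (cycle_prod B \<tau>) (other_leaders T (Min T) \<tau>))))" for T \<tau>
  define P where "P xs = {\<tau>. \<tau> permutes \<alpha> - set (i # xs)}" for xs
  have md: "min_rdet B T = (\<Sum>\<tau> | \<tau> permutes T. F T \<tau>)" for T
    by (simp add: min_rdet_def F_def rdet_on_def)
  have eq: "\<alpha> - set (i # xs) = \<alpha> - {i} - set xs" for xs
    by auto
  have finP: "finite (P xs)" for xs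
    unfolding P_def using fin by (intro finite_permutations) auto
  have "(\<Sum>xs\<in>dlists (\<alpha> - {i}). (- 1) ^ length xs * walk B i xs i * min_rdet B (\<alpha> - {i} - set xs))
    = (\<Sum>xs\<in>dlists (\<alpha> - {i}). \<Sum>\<tau>\<in>P xs. (- 1) ^ length xs * walk B i xs i * F (\<alpha> - set (i # xs)) \<tau>)"
    unfolding md P_def sum_distrib_left eq ..
  also have "\<dots> = (\<Sum>(xs, \<tau>)\<in>Sigma (dlists (\<alpha> - {i})) P. (- 1) ^ length xs * walk B i xs i * F (\<alpha> - set (i # xs)) \<tau>)"
    using fin finP by (intro sum.Sigma) auto
  also have "\<dots> = rdet_on \<alpha> i B"
    unfolding rdet_on_def
  \<comment> \<open>Backwards, a permutation yields its cycle at \<open>i\<close> without the head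
    \<open>i\<close>, and its restriction to the points off that cycle, extended by the
    identity.\<close>
  proof (rule sum.reindex_bij_witness[where
      i = "\<lambda>\<sigma>. (tl (support \<sigma> i), \<lambda>y. if y \<in> \<alpha> - set (support \<sigma> i) then \<sigma> y else y)" and
      j = "\<lambda>(xs, \<tau>). \<tau> \<circ> cycle_of_list (i # xs)"], goal_cases)
    case (1 a)
    then obtain xs \<tau> where a: "a = (xs, \<tau>)" "xs \<in> dlists (\<alpha> - {i})" "\<tau> permutes \<alpha> - set (i # xs)"
      by (auto simp: P_def)
    note P = permutes_comp_cycle[OF fin i a(2,3)]
    show ?case unfolding a(1) prod.case P(3) using P(5) by simp
  next
    case (2 a)
    then show ?case using permutes_comp_cycle(1)[OF fin i] by (auto simp: P_def)
  next
    case (3 \<sigma>)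
    hence s: "\<sigma> permutes \<alpha>" by simp
    have perm: "permutation \<sigma>" using s fin permutation_permutes by blast
    have sup: "i # tl (support \<sigma> i) = support \<sigma> i"
      using least_power_of_permutation(2)[OF perm, of i] by (simp add: upt_rec)
    let ?t = "\<lambda>y. if y \<in> \<alpha> - set (support \<sigma> i) then \<sigma> y else y"
    have t: "?t permutes \<alpha> - set (support \<sigma> i)" by (rule semidecomposition[OF s fin])
    show ?case
      unfolding prod.case sup
    proof
      fix y
      show "(?t \<circ> cycle_of_list (support \<sigma> i)) y = \<sigma> y"
      proof (cases "y \<in> set (support \<sigma> i)")
        case True
        hence e: "cycle_of_list (support \<sigma> i) y = \<sigma> y" using cycle_restrict[OF perm, of y i] by simp
        have "\<sigma> y \<in> set (support \<sigma> i)"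
          using True cycle_is_surj[OF cycle_of_permutation[OF perm], of i] e by (metis imageI)
        thus ?thesis using e by (simp del: set_map)
      next
        case False
        hence "cycle_of_list (support \<sigma> i) y = y" by (rule id_outside_supp)
        moreover have "y \<notin> \<alpha> \<Longrightarrow> \<sigma> y = y" using s by (simp add: permutes_def)
        ultimately show ?thesis using False by (simp del: set_map)
      qed
    qed
  next
    case (4 \<sigma>)
    hence s: "\<sigma> permutes \<alpha>" by simp
    have perm: "permutation \<sigma>" using s fin permutation_permutes by blast
    have sup: "i # tl (support \<sigma> i) = support \<sigma> i"
      using least_power_of_permutation(2)[OF perm, of i] by (simp add: upt_rec)
    have "distinct (i # tl (support \<sigma> i))" unfolding sup by (rule cycle_of_permutation[OF perm])
    moreover have "set (i # tl (support \<sigma> i)) \<subseteq> \<alpha>" unfolding sup by (rule support_subset[OF s i])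
    ultimately have "tl (support \<sigma> i) \<in> dlists (\<alpha> - {i})" by (auto simp: dlists_def simp del: map_tl)
    thus ?case
      using semidecomposition[OF s fin, of i] unfolding P_def
      by (simp only: mem_Sigma_iff mem_Collect_eq sup)
  next
    case (5 a)
    then obtain xs \<tau> where a: "a = (xs, \<tau>)" "xs \<in> dlists (\<alpha> - {i})" "\<tau> permutes \<alpha> - set (i # xs)"
      by (auto simp: P_def)
    show ?case unfolding a(1) prod.case F_def by (rule leaders_summand[OF fin i a(2,3)])
  qed
  finally show ?thesis ..
qed

section \<open>Quaternions\<close>

lemma quat_sel_simps [simp]:
  "qre (x + y) = qre x + qre y" "qi (x + y) = qi x + qi y" "qj (x + y) = qj x + qj y" "qk (x + y) = qk x + qk y"
  "qre (x - y) = qre x - qre y" "qi (x - y) = qi x - qi y" "qj (x - y) = qj x - qj y" "qk (x - y) = qk x - qk y"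
  "qre (- x) = - qre x" "qi (- x) = - qi x" "qj (- x) = - qj x" "qk (- x) = - qk x"
  "qre 0 = 0" "qi 0 = 0" "qj 0 = 0" "qk 0 = 0"
  "qre 1 = 1" "qi 1 = 0" "qj 1 = 0" "qk 1 = 0"
  "qre (of_real r) = r" "qi (of_real r) = 0" "qj (of_real r) = 0" "qk (of_real r) = 0"
  by (simp_all add: plus_quat_def minus_quat_def uminus_quat_def zero_quat_def one_quat_def
      of_real_def scaleR_quat_def)

lemma qre_sum: "qre (sum f S) = (\<Sum>x\<in>S. qre (f x))"
  by (induction S rule: infinite_finite_induct) auto

text \<open>This stands in for commutativity when closed walks are rotated and when traces of
  products are compared.\<close>

lemma qre_mult_commute: "qre (x * y) = qre (y * x)"
  by (simp add: times_quat_def)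

lemma of_real_mult_quat_commute: "x * of_real r = of_real r * (x :: quat)"
  by (simp add: of_real_def)

lemma qre_of_real_mult [simp]: "qre (of_real r * x) = r * qre x" "qre (x * of_real r) = r * qre x"
  by (simp_all add: of_real_def scaleR_quat_def one_quat_def times_quat_def)

lemma qre_minus_one_power_mult [simp]: "qre ((- 1) ^ n * x) = (- 1) ^ n * qre x"
  by (cases "even n") auto

lemma qcnj_simps [simp]:
  "qcnj (x + y) = qcnj x + qcnj y" "qcnj (x - y) = qcnj x - qcnj y" "qcnj (- x) = - qcnj x"
  "qcnj 0 = 0" "qcnj 1 = 1" "qcnj (of_real r) = of_real r" "qcnj (qcnj x) = x"
  "qcnj (x * y) = qcnj y * qcnj x"
  by (simp_all add: quat_eq_iff qcnj_def) (simp_all add: times_quat_def)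

lemma qcnj_sum: "qcnj (sum f S) = (\<Sum>x\<in>S. qcnj (f x))"
  by (induction S rule: infinite_finite_induct) auto

lemma qcnj_eq_self: "qcnj x = x \<Longrightarrow> x = of_real (qre x)"
  by (auto simp: quat_eq_iff qcnj_def)

lemma qcnj_sgn_mult_of_real:
  "qcnj ((- 1) ^ n * x * of_real r) = (- 1) ^ n * qcnj x * of_real r"
  by (cases "even n") (auto simp: of_real_mult_quat_commute)

lemma qcnj_mult_self: "qcnj x * x = of_real ((qre x)\<^sup>2 + (qi x)\<^sup>2 + (qj x)\<^sup>2 + (qk x)\<^sup>2)"
  unfolding quat_eq_iff quat_sel_simps by (simp add: qcnj_def times_quat_def power2_eq_square)

section \<open>Row determinants of Hermitian matrices\<close>

text \<open>Indexes both the interiors of two disjoint cycles and the two pieces into which a point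
  cuts one walk.\<close>

definition dpairs :: "nat set \<Rightarrow> (nat list \<times> nat list) set" where
  "dpairs T = {(xs, ys). distinct (xs @ ys) \<and> set (xs @ ys) \<subseteq> T}"

lemma dpairs_eq_Sigma: "dpairs T = Sigma (dlists T) (\<lambda>xs. dlists (T - set xs))"
  by (auto simp: dpairs_def dlists_def)

lemma sum_dpairs:
  fixes f :: "nat list \<Rightarrow> nat list \<Rightarrow> 'a :: comm_monoid_add"
  assumes "finite T"
  shows "(\<Sum>xs\<in>dlists T. \<Sum>ys\<in>dlists (T - set xs). f xs ys) = (\<Sum>(xs, ys)\<in>dpairs T. f xs ys)"
  unfolding dpairs_eq_Sigma using assms by (intro sum.Sigma) auto

lemma sum_dpairs_swap:
  "(\<Sum>(xs, ys)\<in>dpairs T. f xs ys) = (\<Sum>(xs, ys)\<in>dpairs T. f ys xs)"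
  by (rule sum.reindex_bij_witness[where i = prod.swap and j = prod.swap])
    (auto simp: dpairs_def)

text \<open>A list either avoids \<open>k\<close> or, as \<open>k\<close> occurs only once, splits
  at it in a unique way.\<close>

lemma sum_dlists_insert:
  fixes f :: "nat list \<Rightarrow> 'a :: comm_monoid_add"
  assumes "finite T" "k \<notin> T"
  shows "(\<Sum>xs\<in>dlists (insert k T). f xs) =
    (\<Sum>xs\<in>dlists T. f xs) + (\<Sum>(xs, ys)\<in>dpairs T. f (xs @ k # ys))"
proof -
  let ?h = "\<lambda>(xs, ys). xs @ k # ys"
  have "dlists (insert k T) = dlists T \<union> ?h ` dpairs T"
  proof (intro equalityI subsetI)
    fix xs assume xs: "xs \<in> dlists (insert k T)"
    show "xs \<in> dlists T \<union> ?h ` dpairs T"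
    proof (cases "k \<in> set xs")
      case True
      then obtain ys zs where "xs = ys @ k # zs" by (meson split_list)
      moreover from this have "(ys, zs) \<in> dpairs T" using xs by (auto simp: dlists_def dpairs_def)
      ultimately show ?thesis by force
    qed (use xs in \<open>auto simp: dlists_def\<close>)
  qed (use assms in \<open>auto simp: dlists_def dpairs_def\<close>)
  moreover have "dlists T \<inter> ?h ` dpairs T = {}"
    using assms by (auto simp: dlists_def)
  moreover have "inj_on ?h (dpairs T)"
    using assms by (auto simp: inj_on_def dpairs_def dest!: append_Cons_eq_iff[THEN iffD1, rotated 2])
  moreover have "finite (dpairs T)"
    unfolding dpairs_eq_Sigma using assms by auto
  ultimately show ?thesis
    using assms by (simp add: sum.union_disjoint sum.reindex case_prod_unfold o_def)
qed

lemma sum_dlists_Cons: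
  fixes f :: "nat list \<Rightarrow> 'a :: comm_monoid_add"
  assumes "finite T"
  shows "(\<Sum>xs\<in>dlists T. f xs) = f [] + (\<Sum>k\<in>T. \<Sum>ys\<in>dlists (T - {k}). f (k # ys))"
proof -
  let ?h = "\<lambda>(k, ys). k # ys" let ?S = "Sigma T (\<lambda>k. dlists (T - {k}))"
  have "dlists T = insert [] (?h ` ?S)"
  proof (intro equalityI subsetI)
    fix xs assume "xs \<in> dlists T"
    hence "\<exists>p\<in>?S. xs = ?h p" if "xs \<noteq> []"
      by (intro bexI[of _ "(hd xs, tl xs)"]) (use that in \<open>cases xs; auto simp: dlists_def\<close>)+
    thus "xs \<in> insert [] (?h ` ?S)"
      by blast
  qed (auto simp: dlists_def)
  moreover have "finite (?h ` ?S)" "[] \<notin> ?h ` ?S"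
    using assms by auto
  ultimately have "sum f (dlists T) = f [] + sum f (?h ` ?S)"
    by simp
  also have "sum f (?h ` ?S) = (\<Sum>(k, ys)\<in>?S. f (k # ys))"
    by (subst sum.reindex) (auto simp: inj_on_def case_prod_unfold)
  also have "\<dots> = (\<Sum>k\<in>T. \<Sum>ys\<in>dlists (T - {k}). f (k # ys))"
    using assms by (intro sum.Sigma[symmetric]) auto
  finally show ?thesis .
qed

lemma sum_dlists_rev: "(\<Sum>xs\<in>dlists T. f (rev xs)) = (\<Sum>xs\<in>dlists T. f xs)"
  by (rule sum.reindex_bij_witness[where i = rev and j = rev]) (auto simp: dlists_def)

section \<open>Weights of walks and expansion along a replaced row\<close>

lemma walk_append_Cons: "walk B s (xs @ k # ys) t = walk B s xs k * walk B k ys t"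
  by (induction B s xs k rule: walk.induct) (auto simp: mult.assoc)

lemma qre_walk_rotate: "qre (walk B i (xs @ k # ys) i) = qre (walk B k (ys @ i # xs) k)"
  unfolding walk_append_Cons by (rule qre_mult_commute)

lemma walk_cong:
  assumes "\<And>i j. i \<in> insert s (set xs) \<Longrightarrow> j \<in> insert t (set xs) \<Longrightarrow> B $$ (i, j) = B' $$ (i, j)"
  shows "walk B s xs t = walk B' s xs t"
  using assms by (induction B s xs t rule: walk.induct) auto

lemma min_rdet_cong:
  assumes "finite T" "\<And>i j. i \<in> T \<Longrightarrow> j \<in> T \<Longrightarrow> B $$ (i, j) = B' $$ (i, j)"
  shows "min_rdet B T = min_rdet B' T"
proof (cases "T = {}")
  case False
  have cp: "cycle_prod B \<sigma> s = cycle_prod B' \<sigma> s" if "\<sigma> permutes T" "s \<in> T" for \<sigma> s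
    unfolding cycle_prod_def using support_subset[OF that] permutes_in_image[OF that(1)] assms(2)
    by (intro arg_cong[of _ _ prod_list] map_cong refl) (auto simp del: set_map)
  have "Min T \<in> T" using assms(1) False by simp
  moreover have "set (other_leaders T i \<sigma>) \<subseteq> T" for i \<sigma>
    unfolding other_leaders_def using assms(1) by auto
  ultimately have "rdet_on T (Min T) B = rdet_on T (Min T) B'"
    unfolding rdet_on_def using cp
    by (intro sum.cong refl arg_cong2[of _ _ _ _ "(*)"] arg_cong[of _ _ prod_list] map_cong) blast+
  thus ?thesis by (simp add: min_rdet_def)
qed (simp add: min_rdet_def)

text \<open>The sum in \<open>rdet_on_decomp\<close> with its end points freed. For
  \<open>s = t\<close> outside \<open>U\<close> it is the row determinant along \<open>s\<close> on
  \<open>insert s U\<close>; for distinct end points outside \<open>U\<close> it is a cofactor up to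
  sign.\<close>

definition walk_sum :: "quat mat \<Rightarrow> nat set \<Rightarrow> nat \<Rightarrow> nat \<Rightarrow> quat" where
  "walk_sum B U s t = (\<Sum>xs\<in>dlists U. (- 1) ^ length xs * walk B s xs t * min_rdet B (U - set xs))"

text \<open>Sorts the walks by their first step: straight to \<open>t\<close>, or to some
  \<open>k\<close> in \<open>U\<close> that is removed afterwards. The additional interior point
  changes the sign.\<close>

lemma walk_sum_expand:
  assumes "finite U"
  shows "walk_sum B U s t = B $$ (s, t) * min_rdet B U - (\<Sum>k\<in>U. B $$ (s, k) * walk_sum B (U - {k}) k t)"
proof -
  have "walk_sum B U s t = B $$ (s, t) * min_rdet B U + (\<Sum>k\<in>U. \<Sum>ys\<in>dlists (U - {k}).
     (- 1) ^ Suc (length ys) * (B $$ (s, k) * walk B k ys t) * min_rdet B (U - {k} - set ys))"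
    unfolding walk_sum_def by (subst sum_dlists_Cons[OF assms])
      (simp add: Diff_insert2[of U _ "set _"])
  also have "(\<Sum>k\<in>U. \<Sum>ys\<in>dlists (U - {k}).
     (- 1) ^ Suc (length ys) * (B $$ (s, k) * walk B k ys t) * min_rdet B (U - {k} - set ys)) =
     (\<Sum>k\<in>U. - (B $$ (s, k) * walk_sum B (U - {k}) k t))"
  proof -
    have "(- 1) ^ Suc n * (a * w) * d = - (a * ((- 1) ^ n * w * d))" for n and a w d :: quat
      by (cases "even n") (auto simp: mult.assoc)
    thus ?thesis unfolding walk_sum_def sum_distrib_left by (simp add: sum_negf)
  qed
  finally show ?thesis by (simp add: sum_negf)
qed

text \<open>Row \<open>j\<close> enters only through the first step of the walk from
  \<open>j\<close>; later steps and the remaining cycles see rows of \<open>B\<close>. So the result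
  is linear in \<open>c\<close>, with coefficients on the right.\<close>

lemma rdet_on_replace_row:
  assumes B: "B \<in> carrier_mat m m" and a: "\<alpha> \<subseteq> {..<m}" and j: "j \<in> \<alpha>"
  shows "rdet_on \<alpha> j (replace_row B j c) = c $$ (0, j) * min_rdet B (\<alpha> - {j}) -
    (\<Sum>k\<in>\<alpha> - {j}. c $$ (0, k) * walk_sum B (\<alpha> - {j} - {k}) k j)"
proof -
  let ?R = "replace_row B j c"
  have fin: "finite \<alpha>" using a finite_subset by blast
  have R: "?R $$ (i, k) = (if i = j then c $$ (0, k) else B $$ (i, k))" if "i \<in> \<alpha>" "k \<in> \<alpha>" for i k
    using subsetD[OF a that(1)] subsetD[OF a that(2)] B by (simp add: replace_row_def)
  have md: "min_rdet ?R T = min_rdet B T" if "T \<subseteq> \<alpha> - {j}" for T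
  proof (rule min_rdet_cong)
    show "finite T" using finite_subset[OF that] fin by simp
    fix i k assume "i \<in> T" "k \<in> T"
    hence "i \<in> \<alpha>" "k \<in> \<alpha>" "i \<noteq> j" using that by auto
    thus "?R $$ (i, k) = B $$ (i, k)" by (simp add: R)
  qed
  have ws: "walk_sum ?R (\<alpha> - {j} - {k}) k j = walk_sum B (\<alpha> - {j} - {k}) k j" if k: "k \<in> \<alpha> - {j}" for k
    unfolding walk_sum_def
  proof (rule sum.cong[OF refl])
    fix xs assume xs: "xs \<in> dlists (\<alpha> - {j} - {k})"
    have "walk ?R k xs j = walk B k xs j"
      by (rule walk_cong, subst R) (use xs k j in \<open>auto simp: dlists_def\<close>)
    moreover have "min_rdet ?R (\<alpha> - {j} - {k} - set xs) = min_rdet B (\<alpha> - {j} - {k} - set xs)"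
      by (rule md) auto
    ultimately show "(- 1) ^ length xs * walk ?R k xs j * min_rdet ?R (\<alpha> - {j} - {k} - set xs) =
       (- 1) ^ length xs * walk B k xs j * min_rdet B (\<alpha> - {j} - {k} - set xs)" by simp
  qed
  have "rdet_on \<alpha> j ?R = walk_sum ?R (\<alpha> - {j}) j j"
    unfolding walk_sum_def by (rule rdet_on_decomp[OF fin j])
  also have "\<dots> = ?R $$ (j, j) * min_rdet ?R (\<alpha> - {j}) - (\<Sum>k\<in>\<alpha> - {j}. ?R $$ (j, k) * walk_sum ?R (\<alpha> - {j} - {k}) k j)"
    by (rule walk_sum_expand) (use fin in simp)
  also have "\<dots> = c $$ (0, j) * min_rdet B (\<alpha> - {j}) -
    (\<Sum>k\<in>\<alpha> - {j}. c $$ (0, k) * walk_sum B (\<alpha> - {j} - {k}) k j)"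
    using ws j by (intro arg_cong2[of _ _ _ _ "(-)"] sum.cong) (auto simp: md R)
  finally show ?thesis .
qed

section \<open>Conjugation of walks, realness, and independence of the chosen row\<close>

lemma qcnj_entry:
  assumes "hermitian G" "G \<in> carrier_mat m m" "i < m" "j < m"
  shows "qcnj (G $$ (i, j)) = G $$ (j, i)"
proof -
  have "ctrans G $$ (j, i) = qcnj (G $$ (i, j))" using assms by (simp add: ctrans_def)
  thus ?thesis using assms(1) by (simp add: hermitian_def)
qed

context
  fixes G :: "quat mat" and m :: nat
  assumes G: "G \<in> carrier_mat m m" and herm: "hermitian G"
begin

lemma qcnj_walk:
  assumes "s < m" "t < m" "set xs \<subseteq> {..<m}"
  shows "qcnj (walk G s xs t) = walk G t (rev xs) s"
  using assms
proof (induction xs arbitrary: s)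
  case Nil thus ?case using qcnj_entry[OF herm G] by simp
next
  case (Cons x xs)
  have "qcnj (walk G s (x # xs) t) = walk G t (rev xs) x * G $$ (x, s)"
    using Cons qcnj_entry[OF herm G, of s x] by simp
  also have "\<dots> = walk G t (rev xs @ x # []) s" unfolding walk_append_Cons by simp
  finally show ?case by simp
qed

text \<open>
  A closed walk and its reversal have conjugate weights, and reversing the walks permutes the
  summands. So only real parts survive, and these are invariant under cyclic rotation of the walk;
  this makes the expansions along two different rows agree.
\<close>

lemma rdet_on_hermitian_aux:
  assumes "T \<subseteq> {..<m}"
  shows "min_rdet G T = of_real (qre (min_rdet G T)) \<and>
    (\<forall>i\<in>T. min_rdet G T = rdet_on T i G) \<and>
    (\<forall>i\<in>T. qre (min_rdet G T) = (\<Sum>xs\<in>dlists (T - {i}). (- 1) ^ length xs * qre (walk G i xs i) *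
      qre (min_rdet G (T - {i} - set xs))))"
  using finite_subset[OF assms finite_lessThan] assms
\<comment> \<open>Realness and independence of the row share one induction: determinants of proper
  subsets must be real for conjugation to act on the walks alone, and must be expandable along any
  row.\<close>
proof (induction T rule: finite_psubset_induct)
  case (psubset T)
  define D where "D U = qre (min_rdet G U)" for U
  define V where "V i T = (\<Sum>xs\<in>dlists (T - {i}). (- 1) ^ length xs * qre (walk G i xs i) *
      D (T - {i} - set xs))" for i T
  have finU: "finite U" if "U \<subseteq> T" for U using that psubset.hyps(1) finite_subset by blast
  have md: "min_rdet G U = of_real (D U)" if "U \<subset> T" for U
    unfolding D_def using psubset.IH[OF that] psubset.prems that by blast
  have DV: "D U = V i U" if "U \<subset> T" "i \<in> U" for U i
    using psubset.IH[OF that(1)] psubset.prems that unfolding D_def V_def by blast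
  have rV: "rdet_on T i G = of_real (V i T)" if i: "i \<in> T" for i
  proof -
    have im: "i < m" using i psubset.prems by auto
    have eq: "rdet_on T i G = (\<Sum>xs\<in>dlists (T - {i}). (- 1) ^ length xs * walk G i xs i *
        of_real (D (T - {i} - set xs)))"
      unfolding rdet_on_decomp[OF psubset.hyps(1) i] by (rule sum.cong[OF refl], subst md) (use i in auto)
    have "qcnj (rdet_on T i G) = (\<Sum>xs\<in>dlists (T - {i}). (- 1) ^ length (rev xs) * walk G i (rev xs) i *
        of_real (D (T - {i} - set (rev xs))))"
      unfolding eq qcnj_sum qcnj_sgn_mult_of_real
    proof (rule sum.cong[OF refl], goal_cases)
      case (1 xs)
      have "set xs \<subseteq> {..<m}" using 1 psubset.prems by (auto simp: dlists_def)
      thus ?case by (simp add: qcnj_walk[OF im im])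
    qed
    also have "\<dots> = rdet_on T i G" unfolding eq by (rule sum_dlists_rev)
    finally have "rdet_on T i G = of_real (qre (rdet_on T i G))" by (rule qcnj_eq_self)
    also have "qre (rdet_on T i G) = V i T"
      unfolding eq V_def qre_sum by (simp add: mult.commute mult.left_commute)
    finally show ?thesis .
  qed
  have sym: "V i T = V k T" if ik: "i \<in> T" "k \<in> T" "i \<noteq> k" for i k
  proof -
    \<comment> \<open>Walks through \<open>i\<close> either avoid \<open>k\<close>, and then the
      leftover determinant is expanded along \<open>k\<close>, or pass through \<open>k\<close>.
      Exchanging \<open>i\<close> and \<open>k\<close> swaps the two cycles in the first sum and
      rotates the walk in the second.\<close>
    have expand: "V i T = (\<Sum>(xs, ys)\<in>dpairs (T - {i, k}). (- 1) ^ (length xs + length ys) *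
          qre (walk G i xs i) * qre (walk G k ys k) * D (T - {i, k} - set xs - set ys)) -
        (\<Sum>(xs, ys)\<in>dpairs (T - {i, k}). (- 1) ^ (length xs + length ys) *
          qre (walk G i (xs @ k # ys) i) * D (T - {i, k} - set xs - set ys))"
      if ik: "i \<in> T" "k \<in> T" "i \<noteq> k" for i k
    proof -
      let ?U = "T - {i, k}"
      have U: "T - {i} = insert k ?U" "finite ?U" "k \<notin> ?U" using ik finU by auto
      have "V i T = (\<Sum>xs\<in>dlists ?U. (- 1) ^ length xs * qre (walk G i xs i) * D (insert k ?U - set xs)) +
        (\<Sum>(xs, ys)\<in>dpairs ?U. (- 1) ^ length (xs @ k # ys) * qre (walk G i (xs @ k # ys) i) *
            D (insert k ?U - set (xs @ k # ys)))"
        unfolding V_def U(1) by (rule sum_dlists_insert[OF U(2,3)])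
      also have "(\<Sum>xs\<in>dlists ?U. (- 1) ^ length xs * qre (walk G i xs i) * D (insert k ?U - set xs)) =
         (\<Sum>xs\<in>dlists ?U. \<Sum>ys\<in>dlists (?U - set xs). (- 1) ^ (length xs + length ys) *
          qre (walk G i xs i) * qre (walk G k ys k) * D (?U - set xs - set ys))"
      proof (rule sum.cong[OF refl])
        fix xs assume "xs \<in> dlists ?U"
        hence k: "k \<notin> set xs" by (auto simp: dlists_def)
        have "insert k ?U - set xs \<subset> T" "k \<in> insert k ?U - set xs" using ik k by auto
        from DV[OF this] have D: "D (insert k ?U - set xs) = V k (insert k ?U - set xs)" .
        have "insert k ?U - set xs - {k} = ?U - set xs" by auto
        thus "(- 1) ^ length xs * qre (walk G i xs i) * D (insert k ?U - set xs) =
          (\<Sum>ys\<in>dlists (?U - set xs). (- 1) ^ (length xs + length ys) *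
          qre (walk G i xs i) * qre (walk G k ys k) * D (?U - set xs - set ys))"
          unfolding D V_def by (simp add: sum_distrib_left power_add mult_ac)
      qed
      also have "\<dots> = (\<Sum>(xs, ys)\<in>dpairs ?U. (- 1) ^ (length xs + length ys) *
          qre (walk G i xs i) * qre (walk G k ys k) * D (?U - set xs - set ys))"
        by (rule sum_dpairs[OF U(2)])
      also have "(\<Sum>(xs, ys)\<in>dpairs ?U. (- 1) ^ length (xs @ k # ys) * qre (walk G i (xs @ k # ys) i) *
            D (insert k ?U - set (xs @ k # ys))) =
         - (\<Sum>(xs, ys)\<in>dpairs ?U. (- 1) ^ (length xs + length ys) *
          qre (walk G i (xs @ k # ys) i) * D (?U - set xs - set ys))"
      proof -
        have "insert k ?U - set (xs @ k # ys) = ?U - set xs - set ys" for xs ys by auto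
        thus ?thesis unfolding sum_negf[symmetric] by (intro sum.cong refl) (auto simp: power_add)
      qed
      finally show ?thesis by simp
    qed
    let ?U = "T - {i, k}"
    have U: "T - {k, i} = ?U" by auto
    have comm: "?U - set ys - set xs = ?U - set xs - set ys" for xs ys by auto
    have "(\<Sum>(xs, ys)\<in>dpairs ?U. (- 1) ^ (length xs + length ys) *
          qre (walk G i xs i) * qre (walk G k ys k) * D (?U - set xs - set ys)) =
      (\<Sum>(xs, ys)\<in>dpairs ?U. (- 1) ^ (length xs + length ys) *
          qre (walk G k xs k) * qre (walk G i ys i) * D (?U - set xs - set ys))"
      by (subst sum_dpairs_swap, rule sum.cong) (auto simp: comm add.commute)
    moreover have "(\<Sum>(xs, ys)\<in>dpairs ?U. (- 1) ^ (length xs + length ys) *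
          qre (walk G i (xs @ k # ys) i) * D (?U - set xs - set ys)) =
      (\<Sum>(xs, ys)\<in>dpairs ?U. (- 1) ^ (length xs + length ys) *
          qre (walk G k (xs @ i # ys) k) * D (?U - set xs - set ys))"
      by (subst sum_dpairs_swap, rule sum.cong) (auto simp: comm add.commute qre_walk_rotate[of G i])
    ultimately show ?thesis
      unfolding expand[OF ik] expand[OF ik(2,1) ik(3)[symmetric]] U by simp
  qed
  have m: "min_rdet G T = of_real (V i T)" if i: "i \<in> T" for i
  proof -
    have "Min T \<in> T" using i psubset.hyps by (intro Min_in) auto
    hence "min_rdet G T = of_real (V (Min T) T)" using rV i by (auto simp: min_rdet_def)
    also have "V (Min T) T = V i T" using sym[OF \<open>Min T \<in> T\<close> i] by (cases "Min T = i") auto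
    finally show ?thesis .
  qed
  show ?case
  proof (cases "T = {}")
    case False
    then obtain i where "i \<in> T" by blast
    have DT: "D T = V i T" if "i \<in> T" for i
      unfolding D_def m[OF that] by simp
    show ?thesis
    proof (intro conjI ballI)
      show "min_rdet G T = of_real (qre (min_rdet G T))"
        unfolding m[OF \<open>i \<in> T\<close>] by simp
      fix k assume k: "k \<in> T"
      show "min_rdet G T = rdet_on T k G" using m[OF k] rV[OF k] by simp
      show "qre (min_rdet G T) = (\<Sum>xs\<in>dlists (T - {k}). (- 1) ^ length xs * qre (walk G k xs k) *
        qre (min_rdet G (T - {k} - set xs)))"
        using DT[OF k] unfolding D_def V_def .
    qed
  qed (simp add: min_rdet_def)
qed

lemma min_rdet_real: "T \<subseteq> {..<m} \<Longrightarrow> min_rdet G T = of_real (qre (min_rdet G T))"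
  using rdet_on_hermitian_aux by blast

lemma rdet_on_eq_min_rdet: "T \<subseteq> {..<m} \<Longrightarrow> i \<in> T \<Longrightarrow> rdet_on T i G = min_rdet G T"
  using rdet_on_hermitian_aux by auto

lemma hdet_on_eq_min_rdet:
  assumes "T \<subseteq> {..<m}" "T \<noteq> {}"
  shows "hdet_on T G = min_rdet G T"
  unfolding hdet_on_def
  by (rule the_equality) (use assms rdet_on_eq_min_rdet in auto)

lemma walk_sum_closed:
  assumes "T \<subseteq> {..<m}" "i \<in> T"
  shows "walk_sum G (T - {i}) i i = min_rdet G T"
  unfolding walk_sum_def rdet_on_eq_min_rdet[OF assms, symmetric]
  using rdet_on_decomp[OF finite_subset[OF assms(1)] assms(2)] by simp

text \<open>
  A walk from \<open>k\<close> to \<open>i\<close> that returns to \<open>k\<close> cancels against the product of the returning loop,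
  taken as a separate cycle, and the remaining walk.
\<close>

lemma walk_sum_eq_0:
  assumes U: "U \<subseteq> {..<m}" and k: "k \<in> U"
  shows "walk_sum G U k i = 0"
proof -
  let ?W = "U - {k}"
  have W: "U = insert k ?W" "finite ?W" "k \<notin> ?W" using k finite_subset[OF U] by auto
  \<comment> \<open>The leftover determinants are real, hence central, so that the loop can be moved
    in front of the walk.\<close>
  have c: "x * min_rdet G T = min_rdet G T * x" if "T \<subseteq> ?W" for x T
    by (subst (1 2) min_rdet_real) (use that U in \<open>auto simp: of_real_mult_quat_commute\<close>)
  have c': "x * min_rdet G T = min_rdet G T * x" if "T \<subseteq> U" for x T
    by (subst (1 2) min_rdet_real) (use that U in \<open>auto simp: of_real_mult_quat_commute\<close>)
  have sgn: "(- 1 :: quat) ^ length (ys @ k # xs) = - ((- 1) ^ (length xs + length ys))" for xs ys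
    by (simp add: add.commute)
  have "walk_sum G U k i = (\<Sum>xs\<in>dlists ?W. (- 1) ^ length xs * walk G k xs i * min_rdet G (U - set xs)) +
    (\<Sum>(ys, xs)\<in>dpairs ?W. (- 1) ^ length (ys @ k # xs) * walk G k (ys @ k # xs) i * min_rdet G (U - set (ys @ k # xs)))"
    unfolding walk_sum_def by (rule sum_dlists_insert[OF W(2,3), folded W(1)])
  \<comment> \<open>Walks that do not return leave \<open>k\<close> among the remaining points;
    expanding that determinant along \<open>k\<close> produces the loops \<open>ys\<close>.\<close>
  also have "(\<Sum>xs\<in>dlists ?W. (- 1) ^ length xs * walk G k xs i * min_rdet G (U - set xs)) =
    (\<Sum>xs\<in>dlists ?W. \<Sum>ys\<in>dlists (?W - set xs). (- 1) ^ (length xs + length ys) *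
       (walk G k ys k * walk G k xs i) * min_rdet G (?W - set xs - set ys))"
  proof (rule sum.cong[OF refl])
    fix xs assume "xs \<in> dlists ?W"
    hence kx: "k \<notin> set xs" by (auto simp: dlists_def)
    have e: "U - set xs - {k} = ?W - set xs" by auto
    have "U - set xs \<subseteq> {..<m}" using U by blast
    from walk_sum_closed[OF this, of k] have "min_rdet G (U - set xs) = walk_sum G (?W - set xs) k k"
      using k kx unfolding e by simp
    hence "(- 1) ^ length xs * walk G k xs i * min_rdet G (U - set xs) =
       (- 1) ^ length xs * (walk_sum G (?W - set xs) k k * walk G k xs i)"
      using c'[of "U - set xs" "walk G k xs i"] by (simp add: mult.assoc)
    also have "\<dots> = (\<Sum>ys\<in>dlists (?W - set xs). (- 1) ^ (length xs + length ys) *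
       (walk G k ys k * walk G k xs i) * min_rdet G (?W - set xs - set ys))"
      unfolding walk_sum_def sum_distrib_left sum_distrib_right
    proof (rule sum.cong[OF refl])
      fix ys
      have "min_rdet G (?W - set xs - set ys) * walk G k xs i = walk G k xs i * min_rdet G (?W - set xs - set ys)"
        by (rule c[symmetric]) auto
      thus "(- 1) ^ length xs * ((- 1) ^ length ys * walk G k ys k * min_rdet G (?W - set xs - set ys) * walk G k xs i) =
        (- 1) ^ (length xs + length ys) * (walk G k ys k * walk G k xs i) * min_rdet G (?W - set xs - set ys)"
        by (simp add: power_add mult.assoc)
    qed
    finally show "(- 1) ^ length xs * walk G k xs i * min_rdet G (U - set xs) =
      (\<Sum>ys\<in>dlists (?W - set xs). (- 1) ^ (length xs + length ys) *
       (walk G k ys k * walk G k xs i) * min_rdet G (?W - set xs - set ys))" .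
  qed
  also have "\<dots> = (\<Sum>(xs, ys)\<in>dpairs ?W. (- 1) ^ (length xs + length ys) *
       (walk G k ys k * walk G k xs i) * min_rdet G (?W - set xs - set ys))"
    by (rule sum_dpairs[OF W(2)])
  also have "\<dots> = (\<Sum>(ys, xs)\<in>dpairs ?W. (- 1) ^ (length xs + length ys) *
       (walk G k ys k * walk G k xs i) * min_rdet G (?W - set xs - set ys))"
    by (rule sum_dpairs_swap)
  also have "(\<Sum>(ys, xs)\<in>dpairs ?W. (- 1) ^ length (ys @ k # xs) * walk G k (ys @ k # xs) i * min_rdet G (U - set (ys @ k # xs)))
    = - (\<Sum>(ys, xs)\<in>dpairs ?W. (- 1) ^ (length xs + length ys) *
       (walk G k ys k * walk G k xs i) * min_rdet G (?W - set xs - set ys))"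
  proof -
    have "U - set (ys @ k # xs) = ?W - set xs - set ys" for xs ys by auto
    thus ?thesis unfolding sum_negf[symmetric] walk_append_Cons sgn
      by (intro sum.cong refl) auto
  qed
  finally show ?thesis by simp
qed

end

section \<open>Coefficients of the characteristic adjugate\<close>

text \<open>The coefficient of \<open>c $$ (0, k)\<close> in \<open>rdet_on_replace_row\<close>: a
  cofactor for row \<open>j\<close> and column \<open>k\<close>, stored transposed in
  \<open>padj\<close>.\<close>

definition padj_entry :: "quat mat \<Rightarrow> nat set \<Rightarrow> nat \<Rightarrow> nat \<Rightarrow> quat" where
  "padj_entry B \<alpha> j k =
     (if k = j then min_rdet B (\<alpha> - {j}) else - walk_sum B (\<alpha> - {j} - {k}) k j)"

text \<open>
  For Hermitian \<open>B\<close>, \<open>padj B r\<close> and \<open>minor_sum B r\<close> are the coefficients of the adjugate and of the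
  determinant of \<open>t I + B\<close>, as polynomials in \<open>t\<close>.
\<close>

definition padj :: "quat mat \<Rightarrow> nat \<Rightarrow> quat mat" where
  "padj B r = mat (dim_row B) (dim_row B)
     (\<lambda>(k, j). \<Sum>\<alpha> | \<alpha> \<in> idx_with r (dim_row B) j \<and> k \<in> \<alpha>. padj_entry B \<alpha> j k)"

definition minor_sum :: "quat mat \<Rightarrow> nat \<Rightarrow> real" where
  "minor_sum B r = (\<Sum>\<alpha>\<in>idx r (dim_row B). qre (min_rdet B \<alpha>))"

lemma finite_idx [simp]: "finite (idx r m)" "finite (idx_with r m j)"
  unfolding idx_def idx_with_def by (auto intro: finite_subset[of _ "Pow {..<m}"])

lemma mat_mult_entry:
  assumes "A \<in> carrier_mat m k" "B \<in> carrier_mat k n" "i < m" "j < n"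
  shows "(A * B) $$ (i, j) = (\<Sum>l<k. A $$ (i, l) * B $$ (l, j))"
  using assms by (simp add: scalar_prod_def atLeast0LessThan)

lemma rdet_on_replace_row_eq_sum:
  assumes "B \<in> carrier_mat m m" "\<alpha> \<subseteq> {..<m}" "j \<in> \<alpha>"
  shows "rdet_on \<alpha> j (replace_row B j c) = (\<Sum>k\<in>\<alpha>. c $$ (0, k) * padj_entry B \<alpha> j k)"
proof -
  have "finite \<alpha>" using assms finite_subset by blast
  thus ?thesis
    using assms unfolding rdet_on_replace_row[OF assms]
    by (subst sum.remove[of \<alpha> j]) (auto simp: padj_entry_def sum_negf[symmetric] intro!: sum.cong)
qed

text \<open>Pairing row \<open>l\<close> with the cofactors of row \<open>j\<close> amounts to
  letting the walks that end in \<open>j\<close> start from \<open>l\<close>.\<close>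

lemma walk_sum_eq_sum_padj_entry:
  assumes "finite \<alpha>" "j \<in> \<alpha>"
  shows "walk_sum B (\<alpha> - {j}) l j = (\<Sum>k\<in>\<alpha>. B $$ (l, k) * padj_entry B \<alpha> j k)"
  using assms
  by (subst walk_sum_expand, simp, subst sum.remove[of \<alpha> j])
    (auto simp: padj_entry_def sum_negf[symmetric] intro!: sum.cong)

lemma sum_mult_padj:
  assumes B: "B \<in> carrier_mat m m" and j: "j < m"
  shows "(\<Sum>k<m. c k * padj B r $$ (k, j)) = (\<Sum>\<alpha>\<in>idx_with r m j. \<Sum>k\<in>\<alpha>. c k * padj_entry B \<alpha> j k)"
proof -
  have "(\<Sum>k<m. c k * padj B r $$ (k, j)) =
    (\<Sum>k<m. \<Sum>\<alpha> | \<alpha> \<in> idx_with r m j \<and> k \<in> \<alpha>. c k * padj_entry B \<alpha> j k)"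
    using B j by (simp add: padj_def sum_distrib_left)
  also have "\<dots> = (\<Sum>\<alpha>\<in>idx_with r m j. \<Sum>k | k \<in> {..<m} \<and> k \<in> \<alpha>. c k * padj_entry B \<alpha> j k)"
    by (rule sum.swap_restrict) auto
  also have "\<dots> = (\<Sum>\<alpha>\<in>idx_with r m j. \<Sum>k\<in>\<alpha>. c k * padj_entry B \<alpha> j k)"
    by (intro sum.cong) (auto simp: idx_with_def idx_def)
  finally show ?thesis .
qed

lemma sum_rdet_on_replace_row:
  assumes "B \<in> carrier_mat m m" "c \<in> carrier_mat 1 m" "j < m"
  shows "(\<Sum>\<alpha>\<in>idx_with r m j. rdet_on \<alpha> j (replace_row B j c)) = (c * padj B r) $$ (0, j)"
proof -
  have "(\<Sum>\<alpha>\<in>idx_with r m j. rdet_on \<alpha> j (replace_row B j c)) =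
    (\<Sum>\<alpha>\<in>idx_with r m j. \<Sum>k\<in>\<alpha>. c $$ (0, k) * padj_entry B \<alpha> j k)"
    by (intro sum.cong refl rdet_on_replace_row_eq_sum[OF assms(1)]) (auto simp: idx_with_def idx_def)
  also have "\<dots> = (\<Sum>k<m. c $$ (0, k) * padj B r $$ (k, j))"
    by (rule sum_mult_padj[OF assms(1,3), symmetric])
  also have "\<dots> = (c * padj B r) $$ (0, j)"
    by (rule mat_mult_entry[symmetric, of _ 1 _ _ m]) (use assms in \<open>auto simp: padj_def\<close>)
  finally show ?thesis .
qed

text \<open>Removing \<open>j\<close> matches the index sets of size \<open>Suc r\<close> containing
  \<open>j\<close> with those of size \<open>r\<close> avoiding it.\<close>

lemma padj_diag:
  assumes B: "B \<in> carrier_mat m m" and j: "j < m"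
  shows "padj B (Suc r) $$ (j, j) = (\<Sum>\<alpha> | \<alpha> \<in> idx r m \<and> j \<notin> \<alpha>. min_rdet B \<alpha>)"
proof -
  have "padj B (Suc r) $$ (j, j) = (\<Sum>\<alpha> | \<alpha> \<in> idx_with (Suc r) m j \<and> j \<in> \<alpha>. min_rdet B (\<alpha> - {j}))"
    using B j by (simp add: padj_def padj_entry_def)
  also have "\<dots> = (\<Sum>\<alpha> | \<alpha> \<in> idx r m \<and> j \<notin> \<alpha>. min_rdet B \<alpha>)"
    by (rule sum.reindex_bij_witness[where i = "insert j" and j = "\<lambda>\<alpha>. \<alpha> - {j}"])
      (use j in \<open>auto simp: idx_with_def idx_def card_insert_if dest: finite_subset[OF _ finite_lessThan]\<close>)
  finally show ?thesis .
qed

lemma padj_carrier [simp]: "padj B r \<in> carrier_mat (dim_row B) (dim_row B)"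
  by (simp add: padj_def)

lemma padj_0: "padj B 0 = 0\<^sub>m (dim_row B) (dim_row B)"
proof (rule eq_matI)
  fix k j assume "k < dim_row (0\<^sub>m (dim_row B) (dim_row B) :: quat mat)" "j < dim_col (0\<^sub>m (dim_row B) (dim_row B) :: quat mat)"
  moreover have e: "{\<alpha>. \<alpha> \<in> idx_with 0 (dim_row B) j \<and> k \<in> \<alpha>} = {}"
    by (auto simp: idx_with_def idx_def dest: finite_subset[OF _ finite_lessThan])
  ultimately show "padj B 0 $$ (k, j) = 0\<^sub>m (dim_row B) (dim_row B) $$ (k, j)"
    by (simp add: padj_def e del: Collect_empty_eq)
qed (simp_all add: padj_def)

text \<open>No index set is larger than the matrix. This starts the downward induction in
  \<open>exists_last_minor_sum\<close>.\<close>

lemma padj_gt_dim: "padj B (Suc (dim_row B)) = 0\<^sub>m (dim_row B) (dim_row B)"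
proof (rule eq_matI)
  fix k j assume "k < dim_row (0\<^sub>m (dim_row B) (dim_row B) :: quat mat)" "j < dim_col (0\<^sub>m (dim_row B) (dim_row B) :: quat mat)"
  moreover have e: "{\<alpha>. \<alpha> \<in> idx_with (Suc (dim_row B)) (dim_row B) j \<and> k \<in> \<alpha>} = {}"
    by (auto simp: idx_with_def idx_def dest!: subset_eq_atLeast0_lessThan_card[folded lessThan_atLeast0])
  ultimately show "padj B (Suc (dim_row B)) $$ (k, j) = 0\<^sub>m (dim_row B) (dim_row B) $$ (k, j)"
    by (simp add: padj_def e del: Collect_empty_eq)
qed (simp_all add: padj_def)

lemma minor_sum_0: "minor_sum B 0 = 1"
proof -
  have "idx 0 (dim_row B) = {{}}"
    by (auto simp: idx_def dest: finite_subset[OF _ finite_lessThan])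
  thus ?thesis by (simp add: minor_sum_def min_rdet_def)
qed

context
  fixes G :: "quat mat" and m :: nat
  assumes G: "G \<in> carrier_mat m m" and herm: "hermitian G"
begin

lemma of_real_minor_sum: "of_real (minor_sum G r) = (\<Sum>\<alpha>\<in>idx r m. min_rdet G \<alpha>)"
  using G unfolding minor_sum_def of_real_sum
  by (intro sum.cong) (auto simp: idx_def min_rdet_real[OF G herm, symmetric])

text \<open>The bound on \<open>r\<close> excludes the empty index set, for which the description in
  \<open>hdet_on\<close> singles out no value.\<close>

lemma sum_hdet_on:
  assumes "1 \<le> r"
  shows "(\<Sum>\<alpha>\<in>idx r m. hdet_on \<alpha> G) = of_real (minor_sum G r)"
  unfolding of_real_minor_sum
  by (intro sum.cong refl hdet_on_eq_min_rdet[OF G herm]) (use assms in \<open>auto simp: idx_def\<close>)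

text \<open>
  In the entry \<open>(l, j)\<close> of \<open>G * padj G r\<close> with \<open>l \<noteq> j\<close>, the index sets containing \<open>l\<close> contribute 0,
  and those not containing \<open>l\<close> give, after adjoining \<open>l\<close>, the entry of \<open>padj G (Suc r)\<close>.
\<close>

lemma padj_Suc: "padj G (Suc r) = of_real (minor_sum G r) \<cdot>\<^sub>m 1\<^sub>m m - G * padj G r"
proof (rule eq_matI)
  have dim: "dim_row G = m" using G by simp
  show "dim_row (padj G (Suc r)) = dim_row (of_real (minor_sum G r) \<cdot>\<^sub>m 1\<^sub>m m - G * padj G r)"
    "dim_col (padj G (Suc r)) = dim_col (of_real (minor_sum G r) \<cdot>\<^sub>m 1\<^sub>m m - G * padj G r)"
    using G by (simp_all add: padj_def)
  fix l j assume "l < dim_row (of_real (minor_sum G r) \<cdot>\<^sub>m 1\<^sub>m m - G * padj G r)"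
    "j < dim_col (of_real (minor_sum G r) \<cdot>\<^sub>m 1\<^sub>m m - G * padj G r)"
  hence l: "l < m" and j: "j < m" using G by (simp_all add: padj_def)
  have fin: "finite \<alpha>" "\<alpha> \<subseteq> {..<m}" "j \<in> \<alpha>" if "\<alpha> \<in> idx_with r m j" for \<alpha>
    using that finite_subset[of \<alpha> "{..<m}"] by (auto simp: idx_with_def idx_def)
  have "(G * padj G r) $$ (l, j) = (\<Sum>k<m. G $$ (l, k) * padj G r $$ (k, j))"
    by (rule mat_mult_entry) (use G l j in \<open>auto simp: padj_def\<close>)
  also have "\<dots> = (\<Sum>\<alpha>\<in>idx_with r m j. walk_sum G (\<alpha> - {j}) l j)"
    unfolding sum_mult_padj[OF G j] using fin
    by (intro sum.cong refl walk_sum_eq_sum_padj_entry[symmetric]) auto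
  finally have GP: "(G * padj G r) $$ (l, j) = (\<Sum>\<alpha>\<in>idx_with r m j. walk_sum G (\<alpha> - {j}) l j)" .
  have "padj G (Suc r) $$ (l, j) + (G * padj G r) $$ (l, j) = (if l = j then of_real (minor_sum G r) else 0)"
  proof (cases "l = j")
    case True
    have "(G * padj G r) $$ (l, j) = (\<Sum>\<alpha>\<in>idx_with r m j. min_rdet G \<alpha>)"
      unfolding GP unfolding True using fin by (intro sum.cong refl walk_sum_closed[OF G herm]) auto
    moreover have "idx r m = {\<alpha>. \<alpha> \<in> idx r m \<and> j \<notin> \<alpha>} \<union> idx_with r m j"
      by (auto simp: idx_with_def)
    hence "(\<Sum>\<alpha>\<in>idx r m. min_rdet G \<alpha>) =
      (\<Sum>\<alpha> | \<alpha> \<in> idx r m \<and> j \<notin> \<alpha>. min_rdet G \<alpha>) + (\<Sum>\<alpha>\<in>idx_with r m j. min_rdet G \<alpha>)"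
      by (subst sum.union_disjoint[symmetric]) (auto simp: idx_with_def)
    ultimately show ?thesis
      using True by (simp add: padj_diag[OF G j] of_real_minor_sum)
  next
    case False
    have "(G * padj G r) $$ (l, j) = (\<Sum>\<alpha> | \<alpha> \<in> idx_with r m j \<and> l \<notin> \<alpha>. walk_sum G (\<alpha> - {j}) l j)"
      unfolding GP
    proof (rule sum.mono_neutral_right)
      show "\<forall>\<alpha>\<in>idx_with r m j - {\<alpha>. \<alpha> \<in> idx_with r m j \<and> l \<notin> \<alpha>}. walk_sum G (\<alpha> - {j}) l j = 0"
        using fin False by (auto intro!: walk_sum_eq_0[OF G herm])
    qed auto
    also have "\<dots> = (\<Sum>\<alpha> | \<alpha> \<in> idx_with (Suc r) m j \<and> l \<in> \<alpha>. walk_sum G (\<alpha> - {j} - {l}) l j)"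
    proof (rule sum.reindex_bij_witness[where j = "insert l" and i = "\<lambda>\<alpha>. \<alpha> - {l}"], goal_cases)
      case (5 \<alpha>)
      hence "insert l \<alpha> - {j} - {l} = \<alpha> - {j}" by auto
      thus ?case by simp
    qed (use l False in \<open>auto simp: idx_with_def idx_def card_insert_if dest: finite_subset[OF _ finite_lessThan]\<close>)
    also have "\<dots> = - padj G (Suc r) $$ (l, j)"
      using l j False dim by (simp add: padj_def padj_entry_def sum_negf)
    finally show ?thesis using False by simp
  qed
  hence "padj G (Suc r) $$ (l, j) = (if l = j then of_real (minor_sum G r) else 0) - (G * padj G r) $$ (l, j)"
    by (simp add: eq_diff_eq)
  thus "padj G (Suc r) $$ (l, j) = (of_real (minor_sum G r) \<cdot>\<^sub>m 1\<^sub>m m - G * padj G r) $$ (l, j)"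
    using l j dim by (simp add: padj_def del: index_mult_mat(1))
qed

text \<open>By \<open>padj_diag\<close>, a minor on \<open>r\<close> indices is counted once for
  every \<open>j\<close> outside its index set.\<close>

lemma trace_padj_Suc:
  assumes "r \<le> m"
  shows "(\<Sum>j<m. qre (padj G (Suc r) $$ (j, j))) = real (m - r) * minor_sum G r"
proof -
  have "(\<Sum>j<m. qre (padj G (Suc r) $$ (j, j))) =
    (\<Sum>j<m. \<Sum>\<alpha> | \<alpha> \<in> idx r m \<and> j \<notin> \<alpha>. qre (min_rdet G \<alpha>))"
    by (simp add: padj_diag[OF G] qre_sum)
  also have "\<dots> = (\<Sum>\<alpha>\<in>idx r m. \<Sum>j | j \<in> {..<m} \<and> j \<notin> \<alpha>. qre (min_rdet G \<alpha>))"
    by (rule sum.swap_restrict) auto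
  also have "\<dots> = (\<Sum>\<alpha>\<in>idx r m. real (m - r) * qre (min_rdet G \<alpha>))"
  proof (rule sum.cong[OF refl])
    fix \<alpha> assume a: "\<alpha> \<in> idx r m"
    have "{j. j \<in> {..<m} \<and> j \<notin> \<alpha>} = {..<m} - \<alpha>" by auto
    moreover have "card ({..<m} - \<alpha>) = m - r"
      using a finite_subset[of \<alpha> "{..<m}"] by (subst card_Diff_subset) (auto simp: idx_def)
    ultimately show "(\<Sum>j | j \<in> {..<m} \<and> j \<notin> \<alpha>. qre (min_rdet G \<alpha>)) = real (m - r) * qre (min_rdet G \<alpha>)"
      by simp
  qed
  also have "\<dots> = real (m - r) * minor_sum G r"
    using G by (simp add: minor_sum_def sum_distrib_left)
  finally show ?thesis .
qed

end

section \<open>Algebra of quaternion matrices and conjugate transposes\<close>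

lemma mult_mat_assoc:
  "dim_col A = dim_row B \<Longrightarrow> dim_col B = dim_row C \<Longrightarrow> (A * B) * C = A * (B * (C :: quat mat))"
  by (rule assoc_mult_mat[of _ "dim_row A" "dim_row B" _ "dim_row C" _ "dim_col C"])
    (auto intro: carrier_matI)

lemma mat_mult_entry_dim:
  assumes "dim_col A = dim_row B" "i < dim_row A" "j < dim_col B"
  shows "(A * B) $$ (i, j) = (\<Sum>l<dim_row B. A $$ (i, l) * B $$ (l, j))"
  using assms by (simp add: scalar_prod_def atLeast0LessThan)

text \<open>Scalars act from the left; a real one is central and can be moved past the entries of
  \<open>A\<close>.\<close>

lemma mult_of_real_smult:
  "dim_col A = dim_row B \<Longrightarrow> A * (of_real d \<cdot>\<^sub>m B) = of_real d \<cdot>\<^sub>m (A * (B :: quat mat))"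
  by (rule eq_matI)
    (auto simp: mat_mult_entry_dim sum_distrib_left mult.assoc[symmetric] of_real_mult_quat_commute
      simp del: index_mult_mat(1) intro!: sum.cong)

lemma of_real_smult_mult:
  "dim_col A = dim_row B \<Longrightarrow> (of_real d \<cdot>\<^sub>m A) * B = of_real d \<cdot>\<^sub>m (A * (B :: quat mat))"
  by (rule eq_matI)
    (auto simp: mat_mult_entry_dim sum_distrib_left mult.assoc simp del: index_mult_mat(1))

lemma ctrans_dim [simp]: "dim_row (ctrans A) = dim_col A" "dim_col (ctrans A) = dim_row A"
  by (simp_all add: ctrans_def)

lemma ctrans_entry [simp]: "i < dim_col A \<Longrightarrow> j < dim_row A \<Longrightarrow> ctrans A $$ (i, j) = qcnj (A $$ (j, i))"
  by (simp add: ctrans_def)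

lemma ctrans_ctrans [simp]: "ctrans (ctrans A) = A"
  by (rule eq_matI) auto

lemma ctrans_mult: "dim_col A = dim_row B \<Longrightarrow> ctrans (A * B) = ctrans B * ctrans A"
  by (rule eq_matI)
    (auto simp: mat_mult_entry_dim qcnj_sum simp del: index_mult_mat(1) intro!: sum.cong)

lemma ctrans_minus:
  "dim_row A = dim_row B \<Longrightarrow> dim_col A = dim_col B \<Longrightarrow> ctrans (A - B) = ctrans A - ctrans B"
  by (rule eq_matI) auto

lemma ctrans_of_real_smult: "ctrans (of_real d \<cdot>\<^sub>m A) = of_real d \<cdot>\<^sub>m ctrans A"
  by (rule eq_matI) (auto simp: of_real_mult_quat_commute)

lemma ctrans_one [simp]: "ctrans (1\<^sub>m n) = 1\<^sub>m n"
  by (rule eq_matI) auto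

lemma ctrans_zero [simp]: "ctrans (0\<^sub>m m n) = 0\<^sub>m n m"
  by (rule eq_matI) auto

lemma minus_eq_0_mat_iff:
  assumes "dim_row A = dim_row B" "dim_col A = dim_col B"
  shows "A - B = 0\<^sub>m (dim_row A) (dim_col A) \<longleftrightarrow> A = (B :: quat mat)"
proof
  assume e: "A - B = 0\<^sub>m (dim_row A) (dim_col A)"
  show "A = B"
  proof (rule eq_matI)
    fix i j assume ij: "i < dim_row B" "j < dim_col B"
    hence "(A - B) $$ (i, j) = 0" using e assms by simp
    thus "A $$ (i, j) = B $$ (i, j)" using ij by simp
  qed (use assms in auto)
qed (use assms in auto)

text \<open>Each diagonal entry is the sum of the squared norms in a column of
  \<open>Y\<close>.\<close>

lemma ctrans_mult_self_eq_0:
  assumes "ctrans Y * Y = 0\<^sub>m (dim_col Y) (dim_col Y)"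
  shows "Y = 0\<^sub>m (dim_row Y) (dim_col Y)"
proof (rule eq_matI)
  fix i j assume ij: "i < dim_row (0\<^sub>m (dim_row Y) (dim_col Y) :: quat mat)"
    "j < dim_col (0\<^sub>m (dim_row Y) (dim_col Y) :: quat mat)"
  define q where "q x = (qre x)\<^sup>2 + (qi x)\<^sup>2 + (qj x)\<^sup>2 + (qk x)\<^sup>2" for x
  have "(ctrans Y * Y) $$ (j, j) = (\<Sum>l<dim_row Y. qcnj (Y $$ (l, j)) * Y $$ (l, j))"
    using ij by (simp add: mat_mult_entry_dim del: index_mult_mat(1))
  hence "of_real (\<Sum>l<dim_row Y. q (Y $$ (l, j))) = (0 :: quat)"
    using assms ij unfolding qcnj_mult_self q_def by simp
  hence "q (Y $$ (i, j)) = 0"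
    using ij by (subst (asm) of_real_eq_0_iff, subst (asm) sum_nonneg_eq_0_iff) (auto simp: q_def)
  thus "Y $$ (i, j) = 0\<^sub>m (dim_row Y) (dim_col Y) $$ (i, j)"
    using ij by (auto simp: q_def quat_eq_iff add_nonneg_eq_0_iff)
qed auto

lemma hermitian_square_mult_eq_0:
  assumes "hermitian G" "dim_row G = dim_row Y" "G * (G * Y) = 0\<^sub>m (dim_row Y) (dim_col Y)"
  shows "G * Y = 0\<^sub>m (dim_row Y) (dim_col Y)"
proof -
  have G: "ctrans G = G" "dim_col G = dim_row Y"
    using assms(1,2) ctrans_dim(1)[of G] by (simp_all add: hermitian_def)
  have "ctrans (G * Y) * (G * Y) = ctrans Y * (G * (G * Y))"
    using assms(2) G by (simp add: ctrans_mult mult_mat_assoc)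
  also have "\<dots> = 0\<^sub>m (dim_col Y) (dim_col Y)"
    unfolding assms(3) by (subst right_mult_zero_mat') simp_all
  finally show ?thesis using ctrans_mult_self_eq_0[of "G * Y"] assms(2) by simp
qed

lemma of_real_smult_eq_0:
  assumes "d \<noteq> 0" "of_real d \<cdot>\<^sub>m A = 0\<^sub>m (dim_row A) (dim_col A)"
  shows "A = (0\<^sub>m (dim_row A) (dim_col A) :: quat mat)"
proof (rule eq_matI)
  fix i j assume ij: "i < dim_row (0\<^sub>m (dim_row A) (dim_col A) :: quat mat)"
    "j < dim_col (0\<^sub>m (dim_row A) (dim_col A) :: quat mat)"
  hence "(of_real d \<cdot>\<^sub>m A) $$ (i, j) = 0" by (simp add: assms(2))
  thus "A $$ (i, j) = 0\<^sub>m (dim_row A) (dim_col A) $$ (i, j)" using assms(1) ij by simp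
qed auto

lemma hermitian_dim: "hermitian G \<Longrightarrow> dim_col G = dim_row G"
  using ctrans_dim(1)[of G] by (simp add: hermitian_def)

context
  fixes G :: "quat mat" and m :: nat
  assumes G: "G \<in> carrier_mat m m" and herm: "hermitian G"
begin

lemma dim_padj [simp]: "dim_row G = m" "dim_col G = m" "dim_row (padj G r) = m" "dim_col (padj G r) = m"
  using G by (auto simp: padj_def)

text \<open>By the recursion \<open>padj_Suc\<close>, \<open>padj G r\<close> is a polynomial in
  \<open>G\<close> with real coefficients. Later \<open>X\<close> is \<open>G\<close> itself or the
  weight \<open>M\<close>.\<close>

lemma padj_commute:
  assumes X: "X \<in> carrier_mat m m" and c: "X * G = G * X"
  shows "X * padj G r = padj G r * X"
proof (induction r)
  case 0
  show ?case using X by (simp add: padj_0)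
next
  case (Suc r)
  let ?d = "of_real (minor_sum G r) :: quat" and ?P = "padj G r"
  have P: "?P \<in> carrier_mat m m" by auto
  have "X * padj G (Suc r) = X * (?d \<cdot>\<^sub>m 1\<^sub>m m) - X * (G * ?P)"
    unfolding padj_Suc[OF G herm] by (rule mult_minus_distrib_mat[OF X _ mult_carrier_mat[OF G P]]) simp
  also have "X * (?d \<cdot>\<^sub>m 1\<^sub>m m) = (?d \<cdot>\<^sub>m 1\<^sub>m m) * X"
    using X by (simp add: mult_of_real_smult of_real_smult_mult)
  also have "X * (G * ?P) = (G * ?P) * X"
  proof -
    have "X * (G * ?P) = (X * G) * ?P" using X by (simp add: mult_mat_assoc)
    also have "\<dots> = G * (X * ?P)" unfolding c using X by (simp add: mult_mat_assoc)
    also have "\<dots> = (G * ?P) * X" unfolding Suc using X by (simp add: mult_mat_assoc)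
    finally show ?thesis .
  qed
  also have "(?d \<cdot>\<^sub>m 1\<^sub>m m) * X - (G * ?P) * X = padj G (Suc r) * X"
    unfolding padj_Suc[OF G herm] by (rule minus_mult_distrib_mat[OF _ mult_carrier_mat[OF G P] X, symmetric]) simp
  finally show ?case .
qed

lemma hermitian_padj: "ctrans (padj G r) = padj G r"
proof (induction r)
  case 0
  show ?case by (simp add: padj_0)
next
  case (Suc r)
  have "ctrans (padj G (Suc r)) = of_real (minor_sum G r) \<cdot>\<^sub>m 1\<^sub>m m - padj G r * G"
    unfolding padj_Suc[OF G herm] using Suc herm
    by (simp add: ctrans_minus ctrans_of_real_smult ctrans_mult hermitian_def)
  thus ?case using padj_commute[OF G refl] padj_Suc[OF G herm] by simp
qed

text \<open>
  Take the last nonzero coefficient. The later adjugate coefficients are then, up to sign, the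
  products of powers of \<open>G\<close> with the first of them, and the last one vanishes.
\<close>

lemma exists_last_minor_sum:
  obtains p where "p \<le> m" "minor_sum G p \<noteq> 0" "G * padj G (Suc p) = 0\<^sub>m m m"
proof -
  define p where "p = Max {k. k \<le> m \<and> minor_sum G k \<noteq> 0}"
  have fin: "finite {k. k \<le> m \<and> minor_sum G k \<noteq> 0}" by simp
  have p: "p \<le> m \<and> minor_sum G p \<noteq> 0"
    using Max_in[OF fin] minor_sum_0 unfolding p_def by fastforce
  have z: "minor_sum G k = 0" if "p < k" "k \<le> m" for k
  proof (rule ccontr)
    assume "minor_sum G k \<noteq> 0"
    hence "k \<in> {k. k \<le> m \<and> minor_sum G k \<noteq> 0}" using that by blast
    from Max_ge[OF fin this] show False using that unfolding p_def by simp
  qed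
  have "Suc p \<le> Suc m" using p by simp
  hence "G * padj G (Suc p) = 0\<^sub>m m m"
  proof (induction rule: inc_induct)
    case base
    have "padj G (Suc m) = 0\<^sub>m m m" using padj_gt_dim[of G] by simp
    thus ?case using G by simp
  next
    case (step k)
    have "padj G (Suc k) = of_real (- 1) \<cdot>\<^sub>m (G * padj G k)"
      unfolding padj_Suc[OF G herm] using z[of k] step.hyps by (intro eq_matI) (auto simp del: index_mult_mat(1))
    hence "of_real (- 1) \<cdot>\<^sub>m (G * (G * padj G k)) = 0\<^sub>m m m"
      using step.IH by (simp add: mult_of_real_smult del: of_real_minus of_real_1)
    hence "G * (G * padj G k) = 0\<^sub>m m m"
      using of_real_smult_eq_0[of "- 1" "G * (G * padj G k)"] by simp
    thus ?case using hermitian_square_mult_eq_0[OF herm, of "padj G k"] by simp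
  qed
  thus thesis using p that by blast
qed

end

section \<open>Positive definite matrices and rank\<close>

text \<open>The diagonal entry \<open>(j, j)\<close> of the product is the form of \<open>P\<close>
  at column \<open>j\<close> of \<open>Y\<close>, so every column vanishes.\<close>

lemma pos_def_mult_ctrans_eq_0:
  assumes P: "pos_def P" and d: "dim_row P = dim_row Y"
    and z: "ctrans Y * (P * Y) = 0\<^sub>m (dim_col Y) (dim_col Y)"
  shows "Y = 0\<^sub>m (dim_row Y) (dim_col Y)"
proof (rule eq_matI)
  fix i j assume "i < dim_row (0\<^sub>m (dim_row Y) (dim_col Y) :: quat mat)"
    "j < dim_col (0\<^sub>m (dim_row Y) (dim_col Y) :: quat mat)"
  hence ij: "i < dim_row Y" "j < dim_col Y" by simp_all
  have dc: "dim_col P = dim_row Y" using hermitian_dim P d by (simp add: pos_def_def)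
  define x where "x = mat (dim_row Y) 1 (\<lambda>(l, _). Y $$ (l, j))"
  have x: "x \<in> carrier_mat (dim_row P) 1" using d by (simp add: x_def)
  have Px: "(P * x) $$ (l, 0) = (P * Y) $$ (l, j)" if "l < dim_row Y" for l
    using that ij d dc by (simp add: mat_mult_entry_dim x_def del: index_mult_mat(1))
  have "(ctrans x * P * x) $$ (0, 0) = (ctrans x * (P * x)) $$ (0, 0)"
    using d dc by (subst mult_mat_assoc) (simp_all add: x_def)
  also have "\<dots> = (\<Sum>l<dim_row Y. qcnj (Y $$ (l, j)) * (P * x) $$ (l, 0))"
    using d by (subst mat_mult_entry_dim) (simp_all add: x_def del: index_mult_mat(1))
  also have "\<dots> = (ctrans Y * (P * Y)) $$ (j, j)"
    using d ij by (subst mat_mult_entry_dim) (simp_all add: Px del: index_mult_mat(1))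
  finally have "(ctrans x * P * x) $$ (0, 0) = 0" using z ij by simp
  hence "x = 0\<^sub>m (dim_row P) 1" using P x unfolding pos_def_def by fastforce
  hence "x $$ (i, 0) = 0" using ij d by simp
  thus "Y $$ (i, j) = 0\<^sub>m (dim_row Y) (dim_col Y) $$ (i, j)" using ij by (simp add: x_def)
qed auto

lemma pos_def_mult_eq_0:
  assumes P: "pos_def P" and d: "dim_row P = dim_row Y" and z: "P * Y = 0\<^sub>m (dim_row Y) (dim_col Y)"
  shows "Y = 0\<^sub>m (dim_row Y) (dim_col Y)"
proof (rule pos_def_mult_ctrans_eq_0[OF P d])
  show "ctrans Y * (P * Y) = 0\<^sub>m (dim_col Y) (dim_col Y)"
    unfolding z by (subst right_mult_zero_mat') simp_all
qed

lemma pos_def_hermitian: "pos_def P \<Longrightarrow> hermitian P"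
  by (simp add: pos_def_def)

text \<open>
  The last nonzero coefficient \<open>minor_sum P p\<close> has \<open>P * padj P (Suc p) = 0\<close>, hence
  \<open>padj P (Suc p) = 0\<close>. Comparing traces gives \<open>p = m\<close>, so \<open>padj P m\<close> is the inverse up to a scalar.
\<close>

lemma pos_def_inverse:
  assumes P: "P \<in> carrier_mat m m" "pos_def P"
  shows "mat_inv P \<in> carrier_mat m m" "P * mat_inv P = 1\<^sub>m m" "mat_inv P * P = 1\<^sub>m m"
    "ctrans (mat_inv P) = mat_inv P"
proof -
  note h = pos_def_hermitian[OF P(2)]
  note [simp] = dim_padj[OF P(1) h]
  obtain p where p: "p \<le> m" "minor_sum P p \<noteq> 0" "P * padj P (Suc p) = 0\<^sub>m m m"
    by (rule exists_last_minor_sum[OF P(1) h])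
  have z: "padj P (Suc p) = 0\<^sub>m m m"
    using pos_def_mult_eq_0[OF P(2), of "padj P (Suc p)"] p(3) by simp
  have "real (m - p) * minor_sum P p = (\<Sum>j<m. qre (padj P (Suc p) $$ (j, j)))"
    by (rule trace_padj_Suc[OF P(1) h p(1), symmetric])
  also have "\<dots> = 0" by (simp add: z)
  finally have pm: "p = m" using p by simp
  define d where "d = minor_sum P m"
  have d: "d \<noteq> 0" using p pm by (simp add: d_def)
  have "0\<^sub>m m m = of_real d \<cdot>\<^sub>m 1\<^sub>m m - P * padj P m"
    using padj_Suc[OF P(1) h, of m] z pm by (simp add: d_def)
  hence PC: "P * padj P m = of_real d \<cdot>\<^sub>m 1\<^sub>m m"
    using minus_eq_0_mat_iff[of "of_real d \<cdot>\<^sub>m 1\<^sub>m m" "P * padj P m"] by simp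
  define X where "X = of_real (1 / d) \<cdot>\<^sub>m padj P m"
  have X: "X \<in> carrier_mat m m" by (intro carrier_matI) (simp_all add: X_def)
  have dd: "of_real (1 / d) \<cdot>\<^sub>m (of_real d \<cdot>\<^sub>m 1\<^sub>m m) = (1\<^sub>m m :: quat mat)"
    by (rule eq_matI) (use d in \<open>auto simp: of_real_mult[symmetric] simp del: of_real_mult of_real_divide\<close>)
  have PX: "P * X = 1\<^sub>m m"
    unfolding X_def using PC dd by (simp add: mult_of_real_smult del: of_real_divide)
  have XP: "X * P = 1\<^sub>m m"
    unfolding X_def using PC dd padj_commute[OF P(1) h P(1) refl, of m]
    by (simp add: of_real_smult_mult del: of_real_divide)
  have "mat_inv P = X"
    unfolding mat_inv_def
  proof (rule the_equality)
    show "X \<in> carrier_mat (dim_col P) (dim_row P) \<and> inverts_mat P X \<and> inverts_mat X P"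
      using X PX XP by (simp add: inverts_mat_def)
    fix Y assume Y: "Y \<in> carrier_mat (dim_col P) (dim_row P) \<and> inverts_mat P Y \<and> inverts_mat Y P"
    hence Yc: "Y \<in> carrier_mat m m" and "Y * P = 1\<^sub>m m" by (auto simp: inverts_mat_def)
    hence "Y * P * X = X" using X by simp
    moreover have "Y * P * X = Y" using Yc P X PX by (subst assoc_mult_mat[of _ m m _ m _ m]) auto
    ultimately show "Y = X" by simp
  qed
  thus "mat_inv P \<in> carrier_mat m m" "P * mat_inv P = 1\<^sub>m m" "mat_inv P * P = 1\<^sub>m m"
    "ctrans (mat_inv P) = mat_inv P"
    using X PX XP hermitian_padj[OF P(1) h, of m] by (simp_all only: X_def ctrans_of_real_smult)
qed

text \<open>A relation with \<open>c k \<noteq> 0\<close>, multiplied on the right by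
  \<open>inverse (c k)\<close>, would express column \<open>k\<close> through the columns in
  \<open>S\<close>.\<close>

lemma right_indep_cols_insert:
  assumes fin: "finite S" and k: "k \<notin> S" and S: "right_indep_cols A S"
    and ns: "\<nexists>c. \<forall>i<dim_row A. A $$ (i, k) = (\<Sum>s\<in>S. A $$ (i, s) * c s)"
  shows "right_indep_cols A (insert k S)"
  unfolding right_indep_cols_def
proof (intro allI impI)
  fix c assume "\<forall>i<dim_row A. (\<Sum>l\<in>insert k S. A $$ (i, l) * c l) = 0"
  hence c: "A $$ (i, k) * c k + (\<Sum>s\<in>S. A $$ (i, s) * c s) = 0" if "i < dim_row A" for i
    using that fin k by simp
  have "c k = 0"
  proof (rule ccontr)
    assume ck: "c k \<noteq> 0"
    have eq: "A $$ (i, k) = (\<Sum>s\<in>S. A $$ (i, s) * (- c s * inverse (c k)))" if i: "i < dim_row A" for i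
    proof -
      have "A $$ (i, k) = A $$ (i, k) * c k * inverse (c k)" using ck by (simp add: mult.assoc)
      also have "A $$ (i, k) * c k = - (\<Sum>s\<in>S. A $$ (i, s) * c s)"
        using c[OF i] by (simp add: add_eq_0_iff)
      finally show ?thesis by (simp add: sum_distrib_right mult.assoc sum_negf[symmetric])
    qed
    from ns show False
      by (rule notE, intro exI[of _ "\<lambda>s. - c s * inverse (c k)"] allI impI) (rule eq)
  qed
  thus "\<forall>l\<in>insert k S. c l = 0"
    using c S unfolding right_indep_cols_def by auto
qed

text \<open>By \<open>right_indep_cols_insert\<close>, a column outside the span of an independent
  set of maximal size would enlarge it. \<open>Z k\<close> collects the coefficients of column
  \<open>k\<close>.\<close>

lemma exists_column_basis:
  "\<exists>S Z. S \<subseteq> {..<dim_col A} \<and> card S = qrank A \<and> right_indep_cols A S \<and>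
    (\<forall>k<dim_col A. \<forall>i<dim_row A. A $$ (i, k) = (\<Sum>s\<in>S. A $$ (i, s) * Z k s))"
proof -
  let ?R = "{card S |S. S \<subseteq> {..<dim_col A} \<and> right_indep_cols A S}"
  have fin: "finite ?R"
    by (rule finite_subset[of _ "card ` Pow {..<dim_col A}"]) auto
  have "0 \<in> ?R" by (rule CollectI, rule exI[of _ "{}"]) (simp add: right_indep_cols_def)
  hence "qrank A \<in> ?R" unfolding qrank_def using Max_in[OF fin] by blast
  then obtain S where S: "S \<subseteq> {..<dim_col A}" "card S = qrank A" "right_indep_cols A S" by auto
  have finS: "finite S" using S(1) finite_subset by blast
  have "\<exists>c. \<forall>i<dim_row A. A $$ (i, k) = (\<Sum>s\<in>S. A $$ (i, s) * c s)" if k: "k < dim_col A" for k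
  proof (cases "k \<in> S")
    case True
    have "(\<Sum>s\<in>S. A $$ (i, s) * (if s = k then 1 else 0)) = (\<Sum>s\<in>S. if s = k then A $$ (i, s) else 0)" for i
      by (intro sum.cong) auto
    thus ?thesis using True finS by (intro exI[of _ "\<lambda>s. if s = k then 1 else 0"]) simp
  next
    case False
    show ?thesis
    proof (rule ccontr)
      assume "\<not> ?thesis"
      from right_indep_cols_insert[OF finS False S(3) this]
      have "Suc (qrank A) \<in> ?R"
        using S k finS False by (intro CollectI exI[of _ "insert k S"]) auto
      hence "Suc (qrank A) \<le> qrank A" using Max_ge[OF fin] unfolding qrank_def by blast
      thus False by simp
    qed
  qed
  hence "\<exists>Z. \<forall>k<dim_col A. \<forall>i<dim_row A. A $$ (i, k) = (\<Sum>s\<in>S. A $$ (i, s) * Z k s)"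
    by (intro choice) blast
  thus ?thesis using S by blast
qed

text \<open>
  Factor \<open>A = F Z\<close> through a column basis \<open>F\<close>. Since \<open>F\<close> can be cancelled on the left,
  \<open>Z Q F = d I\<close>, and \<open>F Z Q\<close> has the same real trace.
\<close>

lemma trace_eq_rank:
  assumes A: "A \<in> carrier_mat m n" and Q: "Q \<in> carrier_mat n m"
    and AQA: "A * Q * A = of_real d \<cdot>\<^sub>m A"
  shows "(\<Sum>i<m. qre ((A * Q) $$ (i, i))) = d * real (qrank A)"
proof -
  obtain S Z where S: "S \<subseteq> {..<dim_col A}" "card S = qrank A" "right_indep_cols A S"
    and Z: "\<forall>k<dim_col A. \<forall>i<dim_row A. A $$ (i, k) = (\<Sum>s\<in>S. A $$ (i, s) * Z k s)"
    using exists_column_basis[of A] by blast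
  have finS: "finite S" using S(1) finite_subset by blast
  \<comment> \<open>\<open>W\<close> is the product \<open>Z Q\<close>; \<open>AQ\<close> then says
    \<open>A Q = F W\<close>, and \<open>WA\<close> says \<open>W F = d I\<close>.\<close>
  define W where "W s i = (\<Sum>k<n. Z k s * Q $$ (k, i))" for s i
  have AQ: "(A * Q) $$ (i, l) = (\<Sum>s\<in>S. A $$ (i, s) * W s l)" if il: "i < m" "l < m" for i l
  proof -
    have "(A * Q) $$ (i, l) = (\<Sum>k<n. A $$ (i, k) * Q $$ (k, l))"
      by (rule mat_mult_entry[OF A Q il])
    also have "\<dots> = (\<Sum>k<n. \<Sum>s\<in>S. A $$ (i, s) * (Z k s * Q $$ (k, l)))"
    proof (rule sum.cong[OF refl])
      fix k assume "k \<in> {..<n}"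
      hence "A $$ (i, k) = (\<Sum>s\<in>S. A $$ (i, s) * Z k s)" using Z A il by auto
      thus "A $$ (i, k) * Q $$ (k, l) = (\<Sum>s\<in>S. A $$ (i, s) * (Z k s * Q $$ (k, l)))"
        by (simp only: sum_distrib_right mult.assoc)
    qed
    also have "\<dots> = (\<Sum>s\<in>S. A $$ (i, s) * W s l)"
      by (subst sum.swap) (simp add: W_def sum_distrib_left)
    finally show ?thesis .
  qed
  have WA: "(\<Sum>l<m. W s l * A $$ (l, t)) = (if s = t then of_real d else 0)" if s: "s \<in> S" and t: "t \<in> S" for s t
  proof -
    have tn: "t < n" using t S A by auto
    have "(\<Sum>s\<in>S. A $$ (i, s) * ((\<Sum>l<m. W s l * A $$ (l, t)) - (if s = t then of_real d else 0))) = 0"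
      if i: "i < m" for i
    proof -
      have "(\<Sum>s\<in>S. A $$ (i, s) * (\<Sum>l<m. W s l * A $$ (l, t))) = (\<Sum>l<m. (\<Sum>s\<in>S. A $$ (i, s) * W s l) * A $$ (l, t))"
        by (simp add: sum_distrib_left sum_distrib_right mult.assoc) (rule sum.swap)
      also have "\<dots> = (\<Sum>l<m. (A * Q) $$ (i, l) * A $$ (l, t))"
        using i by (simp add: AQ del: index_mult_mat(1))
      also have "\<dots> = (A * Q * A) $$ (i, t)"
        by (rule mat_mult_entry[symmetric, of _ m m _ n]) (use A Q i tn in auto)
      also have "\<dots> = of_real d * A $$ (i, t)"
        unfolding AQA using A i tn by simp
      finally have 1: "(\<Sum>s\<in>S. A $$ (i, s) * (\<Sum>l<m. W s l * A $$ (l, t))) = of_real d * A $$ (i, t)" .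
      have "(\<Sum>s\<in>S. A $$ (i, s) * (if s = t then of_real d else 0)) =
        (\<Sum>s\<in>S. if s = t then A $$ (i, s) * of_real d else 0)"
        by (intro sum.cong) auto
      hence "(\<Sum>s\<in>S. A $$ (i, s) * (if s = t then of_real d else 0)) = A $$ (i, t) * of_real d"
        using finS t by simp
      thus ?thesis using 1 by (simp only: right_diff_distrib sum_subtractf of_real_mult_quat_commute diff_self)
    qed
    hence "(\<Sum>l<m. W s l * A $$ (l, t)) - (if s = t then of_real d else 0) = 0"
      using S(3)[unfolded right_indep_cols_def, rule_format,
          of "\<lambda>s. (\<Sum>l<m. W s l * A $$ (l, t)) - (if s = t then of_real d else 0)"] A s by simp
    thus ?thesis by simp
  qed
  have "(\<Sum>i<m. qre ((A * Q) $$ (i, i))) = (\<Sum>i<m. \<Sum>s\<in>S. qre (W s i * A $$ (i, s)))"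
    by (intro sum.cong refl) (simp add: AQ qre_sum qre_mult_commute[of "A $$ _"] del: index_mult_mat(1))
  also have "\<dots> = (\<Sum>s\<in>S. qre (\<Sum>i<m. W s i * A $$ (i, s)))"
    by (subst sum.swap) (simp add: qre_sum)
  also have "\<dots> = d * real (qrank A)" using S(2) by (simp add: WA)
  finally show ?thesis .
qed

section \<open>The weighted Moore-Penrose inverse\<close>

text \<open>The Hermitian conditions force \<open>A * X = A * Y\<close> and
  \<open>X * A = Y * A\<close>, the weights being invertible. Then
  \<open>X = X A X = X A Y = Y A Y = Y\<close>.\<close>

lemma wmp_inverse_unique:
  assumes A: "A \<in> carrier_mat m n"
    and M: "M \<in> carrier_mat m m" "pos_def M" and N: "N \<in> carrier_mat n n" "pos_def N"
    and X: "is_wmp_inverse M N A X" and Y: "is_wmp_inverse M N A Y"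
  shows "X = Y"
proof -
  note [simp] = carrier_matD[OF A] carrier_matD[OF M(1)] carrier_matD[OF N(1)]
  have [simp]: "dim_row X = n" "dim_col X = m" "dim_row Y = n" "dim_col Y = m"
    using X Y by (auto simp: is_wmp_inverse_def)
  have x: "A * X * A = A" "X * A * X = X" "ctrans (M * A * X) = M * A * X" "ctrans (N * X * A) = N * X * A"
    and y: "A * Y * A = A" "Y * A * Y = Y" "ctrans (M * A * Y) = M * A * Y" "ctrans (N * Y * A) = N * Y * A"
    using X Y by (simp_all add: is_wmp_inverse_def)
  have hM: "ctrans M = M" and hN: "ctrans N = N"
    using M(2) N(2) by (simp_all add: pos_def_def hermitian_def)
  \<comment> \<open>Conjugate transposition reverses the factors and the Hermitian conditions
    restore them, so that \<open>A * X * A\<close> appears and collapses to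
    \<open>A\<close>.\<close>
  have "M * A * X = (M * A * Y) * (A * X)"
    by (subst (1) y(1)[symmetric]) (simp add: mult_mat_assoc)
  also have "\<dots> = ctrans (ctrans (A * X) * (M * A * Y))"
    using y(3) by (simp add: ctrans_mult)
  also have "ctrans (A * X) * (M * A * Y) = ctrans (M * A * X) * (A * Y)"
    using hM by (simp add: ctrans_mult mult_mat_assoc)
  also have "\<dots> = M * (A * X * A) * Y"
    unfolding x(3) by (simp add: mult_mat_assoc)
  finally have MAX: "M * A * X = M * A * Y"
    using x(1) y(3) by simp
  have AX: "A * X = A * Y"
  proof -
    have "mat_inv M * M * (A * X) = mat_inv M * M * (A * Y)"
      using MAX pos_def_inverse(1)[OF M] by (simp add: mult_mat_assoc)
    thus ?thesis using pos_def_inverse(3)[OF M] by simp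
  qed
  have "N * X * A = ctrans (N * X * (A * Y * A))"
    using x(4) y(1) by simp
  also have "N * X * (A * Y * A) = N * X * A * (Y * A)"
    by (simp add: mult_mat_assoc)
  also have "ctrans \<dots> = ctrans (Y * A) * (N * X * A)"
    using x(4) by (simp add: ctrans_mult)
  also have "\<dots> = ctrans (N * Y * A) * (X * A)"
    using hN by (simp add: ctrans_mult mult_mat_assoc)
  also have "\<dots> = N * Y * (A * X * A)"
    unfolding y(4) by (simp add: mult_mat_assoc)
  finally have NXA: "N * X * A = N * Y * A"
    using x(1) by simp
  have XA: "X * A = Y * A"
  proof -
    have "mat_inv N * N * (X * A) = mat_inv N * N * (Y * A)"
      using NXA pos_def_inverse(1)[OF N] by (simp add: mult_mat_assoc)
    thus ?thesis using pos_def_inverse(3)[OF N] by simp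
  qed
  have "X = X * (A * X)" using x(2) by (simp add: mult_mat_assoc)
  also have "\<dots> = X * A * Y" unfolding AX by (simp add: mult_mat_assoc)
  also have "\<dots> = Y" unfolding XA by (rule y(2))
  finally show ?thesis .
qed

lemma weighted_determinantal_representation:
  assumes A: "A \<in> carrier_mat m n"
    and M: "M \<in> carrier_mat m m" "pos_def M" and N: "N \<in> carrier_mat n n" "pos_def N"
    and herm: "hermitian (A * wadj M N A)"
  defines "G \<equiv> A * wadj M N A" and "r \<equiv> qrank A"
  shows "minor_sum G r \<noteq> 0"
    and "wmp_inverse M N A = of_real (1 / minor_sum G r) \<cdot>\<^sub>m (wadj M N A * padj G r)"
proof -
  note Ni = pos_def_inverse[OF N]
  define B where "B = wadj M N A"
  note [simp] = carrier_matD[OF A] carrier_matD[OF M(1)] carrier_matD[OF N(1)] carrier_matD[OF Ni(1)]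
  have B_eq: "B = mat_inv N * (ctrans A * M)"
    by (simp add: B_def wadj_def mult_mat_assoc)
  have [simp]: "dim_row B = n" "dim_col B = m" by (simp_all add: B_eq)
  have G_eq: "G = A * B" by (simp add: G_def B_def)
  have G: "G \<in> carrier_mat m m" unfolding G_eq by (intro carrier_matI) simp_all
  have hG: "hermitian G" using herm by (simp add: G_def)
  note [simp] = dim_padj[OF G hG]
  have hM: "ctrans M = M" using M(2) by (simp add: pos_def_def hermitian_def)
  \<comment> \<open>\<open>H\<close> and \<open>M\<close> are Hermitian, so the Hermitian product
    \<open>G = H * M\<close> also equals \<open>M * H\<close>. Hence \<open>M\<close> commutes with
    \<open>G\<close> and with the matrices \<open>padj G k\<close>.\<close>
  define H where "H = A * (mat_inv N * ctrans A)"
  have [simp]: "dim_row H = m" "dim_col H = m" by (simp_all add: H_def)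
  have GH: "G = H * M" by (simp add: G_eq H_def B_eq mult_mat_assoc)
  have "ctrans H = H" by (simp add: H_def ctrans_mult Ni(4) mult_mat_assoc)
  hence GH': "G = M * H"
    using hG hM unfolding hermitian_def by (metis GH \<open>dim_col H = m\<close> M(1) carrier_matD(1) ctrans_mult)
  have MG: "M * G = G * M"
    by (subst (1) GH, subst GH') (simp add: mult_mat_assoc)
  obtain p where p: "p \<le> m" "minor_sum G p \<noteq> 0" "G * padj G (Suc p) = 0\<^sub>m m m"
    by (rule exists_last_minor_sum[OF G hG])
  define d where "d = minor_sum G p"
  define P where "P = padj G p"
  define C where "C = padj G (Suc p)"
  have [simp]: "dim_row P = m" "dim_col P = m" "dim_row C = m" "dim_col C = m"
    by (simp_all add: P_def C_def)
  have d: "d \<noteq> 0" using p(2) by (simp add: d_def)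
  have C: "C = of_real d \<cdot>\<^sub>m 1\<^sub>m m - G * P"
    unfolding C_def d_def P_def by (rule padj_Suc[OF G hG])
  have hC: "ctrans C = C" and hP: "ctrans P = P"
    unfolding C_def P_def by (rule hermitian_padj[OF G hG])+
  have MC: "M * C = C * M" and MP: "M * P = P * M"
    unfolding C_def P_def by (rule padj_commute[OF G hG M(1) MG])+
  have GP: "G * P = P * G"
    unfolding P_def by (rule padj_commute[OF G hG G refl])
  have aC: "ctrans A * C = 0\<^sub>m n m"
  proof -
    have "M * (H * C) = G * C"
      by (subst GH') (simp add: mult_mat_assoc)
    also have "\<dots> = 0\<^sub>m m m"
      using p(3) by (simp only: C_def)
    finally have "M * (H * C) = 0\<^sub>m m m" .
    hence HC: "H * C = 0\<^sub>m m m"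
      using pos_def_mult_eq_0[OF M(2), of "H * C"] by simp
    \<comment> \<open>\<open>Z\<close> is chosen so that the form of \<open>N\<close> at
      \<open>Z\<close> is \<open>ctrans C * (H * C)\<close>, which vanishes. Hence \<open>Z\<close>
      is zero, and multiplying by \<open>N\<close> recovers \<open>ctrans A * C\<close>.\<close>
    define Z where "Z = mat_inv N * (ctrans A * C)"
    have [simp]: "dim_row Z = n" "dim_col Z = m" by (simp_all add: Z_def)
    have NZ: "N * Z = ctrans A * C"
    proof -
      have "N * Z = (N * mat_inv N) * (ctrans A * C)" by (simp add: Z_def mult_mat_assoc)
      thus ?thesis unfolding Ni(2) by simp
    qed
    have "ctrans Z * (N * Z) = ctrans C * (H * C)"
      unfolding NZ by (simp add: Z_def H_def ctrans_mult Ni(4) mult_mat_assoc)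
    hence "ctrans Z * (N * Z) = 0\<^sub>m m m" unfolding HC by simp
    hence "Z = 0\<^sub>m n m" using pos_def_mult_ctrans_eq_0[OF N(2), of Z] by simp
    thus ?thesis using NZ by simp
  qed
  have CA: "C * A = 0\<^sub>m m n"
    using arg_cong[OF aC, of ctrans] by (simp add: ctrans_mult hC)
  have BC: "B * C = 0\<^sub>m n m"
  proof -
    have "B * C = mat_inv N * ((ctrans A * C) * M)"
      unfolding B_eq using MC by (simp add: mult_mat_assoc)
    thus ?thesis unfolding aC by simp
  qed
  have GPA: "G * P * A = of_real d \<cdot>\<^sub>m A"
  proof -
    have "C * A = of_real d \<cdot>\<^sub>m 1\<^sub>m m * A - G * P * A"
      unfolding C by (rule minus_mult_distrib_mat[of _ m m _ _ n]) (auto intro!: carrier_matI)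
    hence "of_real d \<cdot>\<^sub>m A - G * P * A = 0\<^sub>m m n"
      using CA by (simp add: of_real_smult_mult)
    thus ?thesis using minus_eq_0_mat_iff[of "of_real d \<cdot>\<^sub>m A" "G * P * A"] by simp
  qed
  have BGP: "B * (G * P) = of_real d \<cdot>\<^sub>m B"
  proof -
    have "B * C = B * (of_real d \<cdot>\<^sub>m 1\<^sub>m m) - B * (G * P)"
      unfolding C by (rule mult_minus_distrib_mat[of _ n m _ m]) (auto intro!: carrier_matI)
    hence "of_real d \<cdot>\<^sub>m B - B * (G * P) = 0\<^sub>m n m"
      using BC by (simp add: mult_of_real_smult)
    thus ?thesis using minus_eq_0_mat_iff[of "of_real d \<cdot>\<^sub>m B" "B * (G * P)"] by simp
  qed
  \<comment> \<open>The real trace of \<open>G * P\<close> is \<open>d\<close> times the rank by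
    \<open>trace_eq_rank\<close>, and \<open>m * d - (m - p) * d = p * d\<close> by the formula for
    \<open>C\<close>.\<close>
  have rp: "r = p"
  proof -
    have "(\<Sum>i<m. qre ((A * (B * P)) $$ (i, i))) = d * real (qrank A)"
    proof (rule trace_eq_rank[OF A])
      show "B * P \<in> carrier_mat n m" by (intro carrier_matI) simp_all
      show "A * (B * P) * A = of_real d \<cdot>\<^sub>m A"
        using GPA by (simp add: G_eq mult_mat_assoc)
    qed
    moreover have "A * (B * P) = G * P" by (simp add: G_eq mult_mat_assoc)
    moreover have "qre ((G * P) $$ (i, i)) = d - qre (C $$ (i, i))" if "i < m" for i
      unfolding C using that by (simp del: index_mult_mat(1))
    moreover have "(\<Sum>i<m. qre (C $$ (i, i))) = real (m - p) * d"
      unfolding C_def d_def by (rule trace_padj_Suc[OF G hG p(1)])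
    ultimately have "real m * d - real (m - p) * d = d * real (qrank A)"
      by (simp add: sum_subtractf)
    hence "d * real p = d * real (qrank A)"
      using p(1) by (simp add: of_nat_diff algebra_simps)
    thus ?thesis using d by (simp add: r_def)
  qed
  thus "minor_sum G r \<noteq> 0" using p(2) by simp
  define X where "X = of_real (1 / d) \<cdot>\<^sub>m (B * P)"
  have [simp]: "dim_row X = n" "dim_col X = m" by (simp_all add: X_def)
  have dd: "of_real (1 / d) \<cdot>\<^sub>m (of_real d \<cdot>\<^sub>m Y) = Y" for Y :: "quat mat"
    by (rule eq_matI) (use d in \<open>simp_all add: mult.assoc[symmetric] del: of_real_divide flip: of_real_mult\<close>)
  have AX: "A * X = of_real (1 / d) \<cdot>\<^sub>m (G * P)"
    by (simp add: X_def G_eq mult_of_real_smult mult_mat_assoc del: of_real_divide)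
  have XA: "X * A = of_real (1 / d) \<cdot>\<^sub>m (B * (P * A))"
    by (simp add: X_def of_real_smult_mult mult_mat_assoc del: of_real_divide)
  have wX: "is_wmp_inverse M N A X"
    unfolding is_wmp_inverse_def
  proof (intro conjI)
    show "X \<in> carrier_mat (dim_col A) (dim_row A)" by (intro carrier_matI) simp_all
    show "A * X * A = A"
      unfolding AX by (simp add: of_real_smult_mult GPA dd del: of_real_divide)
    have "X * A * X = X * (A * X)" by (simp add: mult_mat_assoc)
    also have "\<dots> = of_real (1 / d) \<cdot>\<^sub>m (of_real (1 / d) \<cdot>\<^sub>m (B * P * (G * P)))"
      unfolding AX by (simp add: X_def mult_of_real_smult of_real_smult_mult del: of_real_divide)
    also have "B * P * (G * P) = B * (P * G) * P" by (simp add: mult_mat_assoc)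
    also have "\<dots> = of_real d \<cdot>\<^sub>m (B * P)"
      unfolding GP[symmetric] BGP by (simp add: of_real_smult_mult)
    finally show "X * A * X = X" unfolding dd X_def .
    have "M * A * X = of_real (1 / d) \<cdot>\<^sub>m (M * (G * P))"
      using AX by (simp add: mult_mat_assoc mult_of_real_smult del: of_real_divide)
    moreover have "ctrans (M * (G * P)) = M * (G * P)"
    proof -
      have "ctrans (M * (G * P)) = (P * G) * M"
        using hM hP hG by (simp add: ctrans_mult hermitian_def)
      also have "\<dots> = G * (P * M)" unfolding GP[symmetric] by (simp add: mult_mat_assoc)
      also have "\<dots> = (G * M) * P" unfolding MP[symmetric] by (simp add: mult_mat_assoc)
      also have "\<dots> = M * (G * P)" unfolding MG[symmetric] by (simp add: mult_mat_assoc)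
      finally show ?thesis .
    qed
    ultimately show "ctrans (M * A * X) = M * A * X"
      by (simp add: ctrans_of_real_smult del: of_real_divide)
    \<comment> \<open>The leading \<open>N\<close> cancels the inverse inside \<open>B\<close>; what
      is left is Hermitian because \<open>M\<close> and \<open>P\<close> commute.\<close>
    have "N * X * A = N * (X * A)" by (simp add: mult_mat_assoc)
    also have "\<dots> = of_real (1 / d) \<cdot>\<^sub>m ((N * mat_inv N) * (ctrans A * (M * P) * A))"
      unfolding XA B_eq by (simp add: mult_of_real_smult mult_mat_assoc del: of_real_divide)
    also have "\<dots> = of_real (1 / d) \<cdot>\<^sub>m (ctrans A * (M * P) * A)"
      unfolding Ni(2) by (simp del: of_real_divide)
    finally have NXA: "N * X * A = of_real (1 / d) \<cdot>\<^sub>m (ctrans A * (M * P) * A)" .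
    have "ctrans (ctrans A * (M * P) * A) = ctrans A * (P * M) * A"
      using hM hP by (simp add: ctrans_mult mult_mat_assoc)
    thus "ctrans (N * X * A) = N * X * A"
      unfolding NXA ctrans_of_real_smult MP by simp
  qed
  have "wmp_inverse M N A = X"
    unfolding wmp_inverse_def
    using wX wmp_inverse_unique[OF A M N] by (intro the_equality) blast+
  thus "wmp_inverse M N A = of_real (1 / minor_sum G r) \<cdot>\<^sub>m (wadj M N A * padj G r)"
    by (simp only: X_def d_def P_def B_def rp)
qed

section \<open>Cramer's rule for the left system\<close>

theorem theorem5p5:
  fixes A M N b :: "quat mat" and m n :: nat
  assumes "A \<in> carrier_mat m n"
    and "M \<in> carrier_mat m m" and "pos_def M"
    and "N \<in> carrier_mat n n" and "pos_def N"
    and "hermitian (A * wadj M N A)"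
    and "b \<in> carrier_mat 1 n"
  defines "G \<equiv> A * wadj M N A"
    and "g \<equiv> b * wadj M N A"
    and "x \<equiv> b * wmp_inverse M N A"
  shows "(\<forall>r. 1 \<le> r \<and> qrank A = r \<and> r \<le> n \<and> n < m \<longrightarrow>
            (\<forall>j<m. (\<Sum>\<alpha>\<in>idx r m. hdet_on \<alpha> G) \<noteq> 0 \<and>
               x $$ (0, j) = (\<Sum>\<alpha>\<in>idx_with r m j. rdet_on \<alpha> j (replace_row G j g))
                             / (\<Sum>\<alpha>\<in>idx r m. hdet_on \<alpha> G)))
       \<and> (qrank A = m \<longrightarrow>
            (\<forall>j<m. hdet G \<noteq> 0 \<and> x $$ (0, j) = rdet j (replace_row G j g) / hdet G))"
proof -
  define r where "r = qrank A"
  define B where "B = wadj M N A"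
  define d where "d = minor_sum G r"
  have dimB: "dim_row B = n" "dim_col B = m"
    using assms(1,2) pos_def_inverse(1)[OF assms(4,5)] by (auto simp: B_def wadj_def)
  have G: "G \<in> carrier_mat m m" using assms(1) dimB by (auto simp: G_def B_def[symmetric])
  have hG: "hermitian G" using assms(6) by (simp add: G_def)
  have g: "g \<in> carrier_mat 1 m" using assms(7) dimB by (auto simp: g_def B_def[symmetric])
  note [simp] = dim_padj[OF G hG] dimB carrier_matD[OF assms(7)] carrier_matD[OF g]
  note rep = weighted_determinantal_representation[OF assms(1-6), folded G_def r_def B_def]
  have d: "d \<noteq> 0" using rep(1) by (simp add: d_def)
  have "x = of_real (1 / d) \<cdot>\<^sub>m (b * (B * padj G r))"
    unfolding x_def rep(2) d_def[symmetric] by (simp add: mult_of_real_smult del: of_real_divide)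
  also have "b * (B * padj G r) = g * padj G r"
    by (simp add: g_def B_def[symmetric] mult_mat_assoc)
  \<comment> \<open>The scalar stands on the left, whereas division multiplies by the inverse on the
    right; both agree because \<open>d\<close> is real.\<close>
  finally have x: "x $$ (0, j) = (\<Sum>\<alpha>\<in>idx_with r m j. rdet_on \<alpha> j (replace_row G j g)) / of_real d"
    if "j < m" for j
    using that unfolding sum_rdet_on_replace_row[OF G g that]
    by (simp add: of_real_mult_quat_commute divide_inverse of_real_inverse[symmetric]
        del: of_real_inverse index_mult_mat(1))
  have det: "(\<Sum>\<alpha>\<in>idx r m. hdet_on \<alpha> G) = of_real d" if "1 \<le> r"
    unfolding d_def by (rule sum_hdet_on[OF G hG that])
  have full: "hdet G \<noteq> 0 \<and> x $$ (0, j) = rdet j (replace_row G j g) / hdet G"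
    if rm: "r = m" and j: "j < m" for j
  proof -
    \<comment> \<open>For \<open>r = m\<close> the full set is the only index set, and
      \<open>j < m\<close> supplies the \<open>1 \<le> r\<close> that \<open>det\<close> asks
      for.\<close>
    have idx: "idx m m = {{..<m}}"
      using card_subset_eq[of "{..<m}"] by (auto simp: idx_def)
    hence "idx_with m m j = {{..<m}}" using j by (auto simp: idx_with_def)
    moreover have "hdet G = of_real d" using det rm j idx by (simp add: hdet_def)
    moreover have "dim_row (replace_row G j g) = m" by (simp add: replace_row_def)
    ultimately show ?thesis using d x[OF j] rm by (simp add: rdet_def)
  qed
  show ?thesis
    using x det d full unfolding r_def by auto
qed

end
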